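(* There is an absolute constant $c>0$ such that the following holds. Call an input array $C$ of $N$ $n$-bit integers good if $\mathrm{wkt}_C(\vec e_{\mathsf o})/\mathrm{wkt}_C(\vec e_{\mathsf a})\ge c\,\frac{2^{n/6}}{N\log N}$, and bad otherwise; let $g$ and $b$ be the numbers of good and bad inputs. Then $g/b=\Omega\!\left(\frac{2^{n/3}}{N^2}\right)$; in particular, as $n\to\infty$ (with $N$ fixed), $g/b\to\infty$.
   Context: An input is an array $C[1..N]$ of $n$-bit integers (in $\{0,\dots,2^n-1\}$), bits indexed $1$ (least significant) to $n$ (most significant); entries are assumed distinct. An energy vector $\vec e=(e_1,\dots,e_n)$ assigns energy $e_j\ge0$ to bit $j$. An inexact comparison of two items $u,v$ with energy vector $\vec e$ reads each bit $j$ of $u$ and of $v$ independently, flipped with probability $2^{-e_j}$, and orders $u,v$ according to the read values; each comparison uses fresh independent randomness. The array is sorted by randomized quicksort (uniformly random pivot, partition by inexact comparisons with the pivot, recursion). $Q(u,v,\vec e)$ is the event that in the quicksort output $u,v$ are in the wrong relative order, and $\mathrm{wkt}_C(\vec e)=\sum_{1\le a<b\le N}|C[a]-C[b]|\cdot\Pr[Q(C[a],C[b],\vec e)]$ (probability over pivots and comparison errors). $\vec e_{\mathsf a}=(1,2,\dots,n)$ and $\vec e_{\mathsf o}=(\frac{n+1}{2},\dots,\frac{n+1}{2})$. *)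

theory Defs
  imports "HOL-Probability.Probability"
begin

text \<open>Noisy read of the n lowest bits of u: bit j (1-based) is flipped
  independently with probability 2 powr (- e j).\<close>
fun noisy_read :: "(nat \<Rightarrow> real) \<Rightarrow> nat \<Rightarrow> nat \<Rightarrow> nat pmf" where
  "noisy_read e 0 u = return_pmf 0"
| "noisy_read e (Suc k) u =
     bind_pmf (noisy_read e k u) (\<lambda>r.
     bind_pmf (bernoulli_pmf (2 powr (- e (Suc k)))) (\<lambda>f.
     return_pmf (r + (if bit u k \<noteq> f then 2 ^ k else 0))))"

definition cmp_less :: "(nat \<Rightarrow> real) \<Rightarrow> nat \<Rightarrow> nat \<Rightarrow> nat \<Rightarrow> bool pmf" where
  "cmp_less e n x p =
     bind_pmf (noisy_read e n x) (\<lambda>a. bind_pmf (noisy_read e n p) (\<lambda>b. return_pmf (a < b)))"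

fun qs_partition :: "(nat \<Rightarrow> real) \<Rightarrow> nat \<Rightarrow> nat \<Rightarrow> nat list \<Rightarrow> (nat list \<times> nat list) pmf" where
  "qs_partition e n p [] = return_pmf ([], [])"
| "qs_partition e n p (x # xs) =
     bind_pmf (cmp_less e n x p) (\<lambda>c.
     bind_pmf (qs_partition e n p xs) (\<lambda>(L, R).
     return_pmf (if c then (x # L, R) else (L, x # R))))"

text \<open>Randomized quicksort with a fuel argument (fuel = length suffices).\<close>
primrec qs_fuel :: "(nat \<Rightarrow> real) \<Rightarrow> nat \<Rightarrow> nat \<Rightarrow> nat list \<Rightarrow> nat list pmf" where
  "qs_fuel e n 0 xs = return_pmf xs"
| "qs_fuel e n (Suc k) xs =
     (if xs = [] then return_pmf [] else
      bind_pmf (pmf_of_set (set xs)) (\<lambda>p.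
      bind_pmf (qs_partition e n p (filter (\<lambda>x. x \<noteq> p) xs)) (\<lambda>(L, R).
      bind_pmf (qs_fuel e n k L) (\<lambda>sL.
      bind_pmf (qs_fuel e n k R) (\<lambda>sR.
      return_pmf (sL @ [p] @ sR))))))"

definition quicksort :: "(nat \<Rightarrow> real) \<Rightarrow> nat \<Rightarrow> nat list \<Rightarrow> nat list pmf" where
  "quicksort e n xs = qs_fuel e n (length xs) xs"

definition occurs_before :: "nat list \<Rightarrow> nat \<Rightarrow> nat \<Rightarrow> bool" where
  "occurs_before xs x y \<longleftrightarrow>
     (\<exists>i<length xs. \<exists>j<length xs. i < j \<and> xs ! i = x \<and> xs ! j = y)"

definition prob_Q :: "(nat \<Rightarrow> real) \<Rightarrow> nat \<Rightarrow> nat list \<Rightarrow> nat \<Rightarrow> nat \<Rightarrow> real" where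
  "prob_Q e n C u v =
     measure_pmf.prob (quicksort e n C) {out. if u < v then occurs_before out v u else occurs_before out u v}"

definition wkt :: "(nat \<Rightarrow> real) \<Rightarrow> nat \<Rightarrow> nat list \<Rightarrow> real" where
  "wkt e n C = (\<Sum>a<length C. \<Sum>b\<in>{a<..<length C}.
      \<bar>real (C ! a) - real (C ! b)\<bar> * prob_Q e n C (C ! a) (C ! b))"

definition e_a :: "nat \<Rightarrow> real" where
  "e_a j = real j"

definition e_o :: "nat \<Rightarrow> nat \<Rightarrow> real" where
  "e_o n j = (real n + 1) / 2"

definition inputs :: "nat \<Rightarrow> nat \<Rightarrow> nat list set" where
  "inputs N n = {C. length C = N \<and> distinct C \<and> (\<forall>x\<in>set C. x < 2 ^ n)}"

definition good :: "real \<Rightarrow> nat \<Rightarrow> nat \<Rightarrow> nat list \<Rightarrow> bool" where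
  "good c N n C \<longleftrightarrow>
     wkt (e_o n) n C / wkt e_a n C \<ge> c * 2 powr (real n / 6) / (real N * ln (real N))"

end

theory Submission
  imports Defs "HOL-Combinatorics.Transposition"
begin

text \<open>
  Let \<open>d\<close> be the difference of two entries. Under \<open>e_a\<close> a noisy read is off by at least \<open>t\<close> with
  probability at most \<open>2/t\<close>, so whatever the pivot is, one round of quicksort inverts a pair with
  probability \<open>O(1/d)\<close>. A pair survives at most \<open>N\<close> rounds, hence \<open>wkt e_a = O(N^3)\<close> on every input.

  Under \<open>e_o\<close> every bit is flipped with probability \<open>q = 2^(-(n+1)/2)\<close>. If \<open>u < v \<le> w\<close> agree in
  their top bit and \<open>w\<close> is the first pivot, flipping a single top bit already moves \<open>u\<close> to the right
  of \<open>w\<close>, while \<open>v\<close> stays left of \<open>w\<close> with probability at least 1/2. One half of the range contains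
  \<open>N/2\<close> entries, so there are \<open>\<Omega>(N^3)\<close> such triples, and \<open>wkt e_o = \<Omega>(q D N^2)\<close> for
  \<open>D = 2^\<lfloor>2n/3\<rfloor>\<close> unless a constant fraction of all pairs has a gap below \<open>D\<close>. By Markov's
  inequality the latter happens for a fraction \<open>O(D/2^n) = O(2^(-n/3))\<close> of the inputs.

  For \<open>N = 2\<close> with differing top bits and low parts in the same order, two flips are needed under
  either energy vector. There the error probabilities are \<open>\<Omega>(q^2)\<close> and \<open>O(2^(-n)/D)\<close>, provided that
  the gap is at distance at least \<open>D\<close> from \<open>2^(n-1)\<close> as well.
\<close>

subsection \<open>Binding probability mass functions\<close>

lemma prob_bind_pmf:
  "measure_pmf.prob (bind_pmf M f) A = (\<integral>x. measure_pmf.prob (f x) A \<partial>measure_pmf M)"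
  by (simp add: measure_pmf_bind measure_pmf.measure_bind[where N="count_space UNIV"]
      measure_pmf_in_subprob_algebra)

text \<open>Outcomes satisfying \<open>P\<close> may cost an extra \<open>c\<close>, all others only
  \<open>d\<close>. With \<open>c = 1\<close> this is the union bound, with \<open>c = 0\<close> a
  uniform bound.\<close>

lemma prob_bind_pmf_le:
  assumes "\<And>x. x \<in> set_pmf M \<Longrightarrow> measure_pmf.prob (f x) A \<le> (if P x then c else 0) + d"
  shows "measure_pmf.prob (bind_pmf M f) A \<le> c * measure_pmf.prob M {x. P x} + d"
proof -
  have "(\<integral>x. measure_pmf.prob (f x) A \<partial>measure_pmf M)
      \<le> (\<integral>x. c * indicator {x. P x} x + d \<partial>measure_pmf M)"
  proof (rule integral_mono_AE)
    show "integrable (measure_pmf M) (\<lambda>x. measure_pmf.prob (f x) A)"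
      by (rule measure_pmf.integrable_const_bound[where B=1]) auto
    show "integrable (measure_pmf M) (\<lambda>x. c * indicator {x. P x} x + d)"
      by (rule measure_pmf.integrable_const_bound[where B="\<bar>c\<bar> + \<bar>d\<bar>"])
        (auto simp: indicator_def)
    show "AE x in measure_pmf M. measure_pmf.prob (f x) A \<le> c * indicator {x. P x} x + d"
      using assms by (fastforce simp: AE_measure_pmf_iff indicator_def)
  qed
  also have "\<dots> = c * measure_pmf.prob M {x. P x} + d"
    by (subst Bochner_Integration.integral_add)
      (auto simp: measure_pmf.prob_space intro!: measure_pmf.integrable_const_bound[where B=1])
  finally show ?thesis by (simp add: prob_bind_pmf)
qed

lemma prob_bind_pmf_le_const:
  assumes "\<And>x. x \<in> set_pmf M \<Longrightarrow> measure_pmf.prob (f x) A \<le> d"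
  shows "measure_pmf.prob (bind_pmf M f) A \<le> d"
  using prob_bind_pmf_le[of M f A "\<lambda>_. False" 0 d] assms by simp

text \<open>Outcomes outside \<open>P\<close> are dropped. With \<open>c = 1\<close> it serves where
  \<open>P\<close> forces the event, with smaller \<open>c\<close> where a later independent choice
  has to succeed too.\<close>

lemma prob_bind_pmf_ge:
  assumes "\<And>x. x \<in> set_pmf M \<Longrightarrow> P x \<Longrightarrow> c \<le> measure_pmf.prob (f x) A"
  shows "c * measure_pmf.prob M {x. P x} \<le> measure_pmf.prob (bind_pmf M f) A"
proof -
  have "c * measure_pmf.prob M {x. P x} = (\<integral>x. c * indicator {x. P x} x \<partial>measure_pmf M)"
    by simp
  also have "\<dots> \<le> (\<integral>x. measure_pmf.prob (f x) A \<partial>measure_pmf M)"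
  proof (rule integral_mono_AE)
    show "integrable (measure_pmf M) (\<lambda>x. measure_pmf.prob (f x) A)"
      by (rule measure_pmf.integrable_const_bound[where B=1]) auto
    show "integrable (measure_pmf M) (\<lambda>x. c * indicator {x. P x} x)"
      by (rule measure_pmf.integrable_const_bound[where B="\<bar>c\<bar>"])
        (auto simp: indicator_def)
    show "AE x in measure_pmf M. c * indicator {x. P x} x \<le> measure_pmf.prob (f x) A"
      using assms by (auto simp: AE_measure_pmf_iff indicator_def)
  qed
  finally show ?thesis by (simp add: prob_bind_pmf)
qed

lemma prob_bind_pmf_ge_const:
  assumes "\<And>x. x \<in> set_pmf M \<Longrightarrow> c \<le> measure_pmf.prob (f x) A"
  shows "c \<le> measure_pmf.prob (bind_pmf M f) A"
  using prob_bind_pmf_ge[of M "\<lambda>_. True" c f A] assms by (simp)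

lemma prob_bernoulli_pmf:
  assumes "0 \<le> q" "q \<le> 1"
  shows "measure_pmf.prob (bernoulli_pmf q) {f. f} = q"
    "measure_pmf.prob (bernoulli_pmf q) {f. \<not> f} = 1 - q"
proof -
  have *: "{f. f} = {True}" "{f. \<not> f} = {False}" by auto
  show "measure_pmf.prob (bernoulli_pmf q) {f. f} = q"
    "measure_pmf.prob (bernoulli_pmf q) {f. \<not> f} = 1 - q"
    unfolding * measure_pmf_single using assms by auto
qed

subsection \<open>Inversions made by noisy quicksort\<close>

lemma occurs_before_append:
  "occurs_before (xs @ ys) x y \<longleftrightarrow>
     occurs_before xs x y \<or> occurs_before ys x y \<or> (x \<in> set xs \<and> y \<in> set ys)" (is "?l = ?r")
proof
  assume ?l
  then obtain i j where ij: "i < j" "j < length xs + length ys"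
    "(xs @ ys) ! i = x" "(xs @ ys) ! j = y"
    by (auto simp: occurs_before_def)
  consider "j < length xs" | "i \<ge> length xs" | "i < length xs" "j \<ge> length xs" by linarith
  then show ?r
  proof cases
    case 1
    then have "occurs_before xs x y" using ij unfolding occurs_before_def
      by (intro exI[of _ i] conjI exI[of _ j]) (auto simp: nth_append)
    then show ?thesis by simp
  next
    case 2
    then have "occurs_before ys x y" using ij unfolding occurs_before_def
      by (intro exI[of _ "i - length xs"] conjI exI[of _ "j - length xs"])
        (auto simp: nth_append)
    then show ?thesis by simp
  next
    case 3
    then have "x \<in> set xs" "y \<in> set ys"
      using ij nth_mem[of "j - length xs" ys] by (auto simp: nth_append)
    then show ?thesis by simp
  qed
next
  assume ?r
  then consider "occurs_before xs x y" | "occurs_before ys x y" | "x \<in> set xs" "y \<in> set ys" by blast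
  then show ?l
  proof cases
    case 1
    then obtain i j where "i < j" "j < length xs" "xs ! i = x" "xs ! j = y"
      by (auto simp: occurs_before_def)
    then show ?thesis unfolding occurs_before_def
      by (intro exI[of _ i] conjI exI[of _ j]) (auto simp: nth_append)
  next
    case 2
    then obtain i j where "i < j" "j < length ys" "ys ! i = x" "ys ! j = y"
      by (auto simp: occurs_before_def)
    then show ?thesis unfolding occurs_before_def
      by (intro exI[of _ "length xs + i"] conjI exI[of _ "length xs + j"]) (auto simp: nth_append)
  next
    case 3
    then obtain i j where "i < length xs" "j < length ys" "xs ! i = x" "ys ! j = y"
      by (auto simp: in_set_conv_nth)
    then show ?thesis unfolding occurs_before_def
      by (intro exI[of _ i] conjI exI[of _ "length xs + j"]) (auto simp: nth_append)
  qed
qed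

lemma occurs_before_Nil [simp]: "\<not> occurs_before [] x y"
  by (simp add: occurs_before_def)

lemma occurs_before_Cons:
  "occurs_before (z # ys) x y \<longleftrightarrow> occurs_before ys x y \<or> (x = z \<and> y \<in> set ys)"
proof -
  have "\<not> occurs_before [z] x y" by (simp add: occurs_before_def)
  then show ?thesis using occurs_before_append[of "[z]" ys x y] by auto
qed

lemma occurs_before_in_set: "occurs_before xs x y \<Longrightarrow> x \<in> set xs \<and> y \<in> set xs"
  by (auto simp: occurs_before_def)

text \<open>The multiset form yields membership, distinctness and length bounds for both sublists at
  once.\<close>

lemma qs_partition_support:
  "(L, R) \<in> set_pmf (qs_partition e n p xs) \<Longrightarrow> mset L + mset R = mset xs"
proof (induction xs arbitrary: L R)
  case (Cons x xs)
  then show ?case by (force split: if_splits)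
qed simp

lemma qs_fuel_support:
  "out \<in> set_pmf (qs_fuel e n k xs) \<Longrightarrow> set out = set xs"
proof (induction k arbitrary: xs out)
  case (Suc k)
  show ?case
  proof (cases "xs = []")
    case False
    then obtain p L R sL sR where p: "p \<in> set xs"
      and LR: "(L, R) \<in> set_pmf (qs_partition e n p (filter (\<lambda>x. x \<noteq> p) xs))"
      and s: "sL \<in> set_pmf (qs_fuel e n k L)" "sR \<in> set_pmf (qs_fuel e n k R)"
      and out: "out = sL @ [p] @ sR"
      using Suc.prems by (auto simp: set_pmf_of_set)
    have "set L \<union> set R = set xs - {p}"
      using arg_cong[OF qs_partition_support[OF LR], of set_mset] by auto
    then show ?thesis using p out Suc.IH[OF s(1)] Suc.IH[OF s(2)] by auto
  qed (use Suc.prems in simp)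
qed simp

text \<open>A distinct list compares \<open>x\<close> with the pivot at most once, and that
  comparison alone decides its side; \<open>s\<close> is True for the left side.\<close>

lemma prob_qs_partition_side_le:
  assumes "distinct xs"
  shows "measure_pmf.prob (qs_partition e n p xs) {LR. x \<in> set (if s then fst LR else snd LR)}
           \<le> measure_pmf.prob (cmp_less e n x p) {c. c = s}"
  using assms
proof (induction xs)
  case (Cons y xs)
  let ?A = "{LR :: nat list \<times> nat list. x \<in> set (if s then fst LR else snd LR)}"
  show ?case
  proof (cases "x = y")
    case True
    have "measure_pmf.prob (qs_partition e n p (y # xs)) ?A
      \<le> 1 * measure_pmf.prob (cmp_less e n y p) {c. c = s} + 0"
      unfolding qs_partition.simps
    proof (rule prob_bind_pmf_le, goal_cases)
      case (1 c)
      show ?case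
      proof (cases "c = s")
        case False
        have "x \<notin> set L" "x \<notin> set R" if "(L, R) \<in> set_pmf (qs_partition e n p xs)" for L R
          using arg_cong[OF qs_partition_support[OF that], of set_mset] Cons.prems True by auto
        then show ?thesis using False
          by (auto intro!: prob_bind_pmf_le_const split: prod.splits)
      qed auto
    qed
    then show ?thesis using True by simp
  next
    case False
    show ?thesis unfolding qs_partition.simps
    proof (rule prob_bind_pmf_le_const)
      fix c
      have "measure_pmf.prob (qs_partition e n p xs \<bind>
               (\<lambda>(L, R). return_pmf (if c then (y # L, R) else (L, y # R)))) ?A
         \<le> 1 * measure_pmf.prob (qs_partition e n p xs) ?A + 0"
        by (rule prob_bind_pmf_le) (use False in \<open>auto split: prod.splits simp: indicator_def\<close>)
      then show "measure_pmf.prob (qs_partition e n p xs \<bind>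
               (\<lambda>(L, R). return_pmf (if c then (y # L, R) else (L, y # R)))) ?A
         \<le> measure_pmf.prob (cmp_less e n x p) {c. c = s}"
        using Cons by simp
    qed
  qed
qed simp

lemma prob_qs_partition_side_ge:
  assumes "x \<in> set xs"
  shows "measure_pmf.prob (cmp_less e n x p) {c. c = s}
     \<le> measure_pmf.prob (qs_partition e n p xs) {LR. x \<in> set (if s then fst LR else snd LR)}"
  using assms
proof (induction xs)
  case (Cons y xs)
  let ?A = "{LR :: nat list \<times> nat list. x \<in> set (if s then fst LR else snd LR)}"
  show ?case
  proof (cases "x = y")
    case True
    have "1 * measure_pmf.prob (cmp_less e n y p) {c. c = s}
        \<le> measure_pmf.prob (qs_partition e n p (y # xs)) ?A"
      unfolding qs_partition.simps
      by (intro prob_bind_pmf_ge prob_bind_pmf_ge_const) (use True in \<open>auto split: prod.splits\<close>)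
    then show ?thesis using True by simp
  next
    case False
    have "1 * measure_pmf.prob (qs_partition e n p xs) ?A
        \<le> measure_pmf.prob (qs_partition e n p (y # xs)) ?A"
      unfolding qs_partition.simps
      by (rule prob_bind_pmf_ge_const, rule prob_bind_pmf_ge) (auto split: prod.splits simp: indicator_def)
    then show ?thesis using Cons False by simp
  qed
qed simp

text \<open>The two items are compared with the pivot independently, so the probabilities multiply.
  The induction stops at whichever item comes first and leaves the other to the one-item
  bound.\<close>

lemma prob_qs_partition_sides_ge:
  assumes "x \<in> set xs" "y \<in> set xs" "x \<noteq> y"
  shows "measure_pmf.prob (cmp_less e n x p) {c. \<not> c} * measure_pmf.prob (cmp_less e n y p) {c. c}
     \<le> measure_pmf.prob (qs_partition e n p xs) {LR. x \<in> set (snd LR) \<and> y \<in> set (fst LR)}"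
  using assms
proof (induction xs)
  case (Cons z xs)
  let ?A = "{LR :: nat list \<times> nat list. x \<in> set (snd LR) \<and> y \<in> set (fst LR)}"
  consider "z = x" | "z = y" | "z \<noteq> x" "z \<noteq> y" by blast
  then show ?case
  proof cases
    case 1
    then have y: "y \<in> set xs" using Cons.prems by auto
    have "measure_pmf.prob (cmp_less e n y p) {c. c} * measure_pmf.prob (cmp_less e n x p) {c. \<not> c}
      \<le> measure_pmf.prob (qs_partition e n p (z # xs)) ?A"
      unfolding qs_partition.simps 1
    proof (rule prob_bind_pmf_ge)
      fix c :: bool
      assume c: "\<not> c"
      have "1 * measure_pmf.prob (qs_partition e n p xs) {LR. y \<in> set (fst LR)}
        \<le> measure_pmf.prob (qs_partition e n p xs \<bind>
               (\<lambda>(L, R). return_pmf (if c then (x # L, R) else (L, x # R)))) ?A"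
        by (rule prob_bind_pmf_ge) (use c in \<open>auto split: prod.splits simp: indicator_def\<close>)
      then show "measure_pmf.prob (cmp_less e n y p) {c. c}
        \<le> measure_pmf.prob (qs_partition e n p xs \<bind>
               (\<lambda>(L, R). return_pmf (if c then (x # L, R) else (L, x # R)))) ?A"
        using prob_qs_partition_side_ge[OF y, of e n p True] by simp
    qed
    then show ?thesis by (simp add: mult.commute)
  next
    case 2
    then have x: "x \<in> set xs" using Cons.prems by auto
    show ?thesis
      unfolding qs_partition.simps 2
    proof (rule prob_bind_pmf_ge)
      fix c :: bool
      assume c: "c"
      have "1 * measure_pmf.prob (qs_partition e n p xs) {LR. x \<in> set (snd LR)}
        \<le> measure_pmf.prob (qs_partition e n p xs \<bind>
               (\<lambda>(L, R). return_pmf (if c then (y # L, R) else (L, y # R)))) ?A"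
        by (rule prob_bind_pmf_ge) (use c in \<open>auto split: prod.splits simp: indicator_def\<close>)
      then show "measure_pmf.prob (cmp_less e n x p) {c. \<not> c}
        \<le> measure_pmf.prob (qs_partition e n p xs \<bind>
               (\<lambda>(L, R). return_pmf (if c then (y # L, R) else (L, y # R)))) ?A"
        using prob_qs_partition_side_ge[OF x, of e n p False] by simp
    qed
  next
    case 3
    have "1 * measure_pmf.prob (qs_partition e n p xs) ?A
        \<le> measure_pmf.prob (qs_partition e n p (z # xs)) ?A"
      unfolding qs_partition.simps
      by (rule prob_bind_pmf_ge_const, rule prob_bind_pmf_ge) (auto split: prod.splits simp: indicator_def)
    then show ?thesis using Cons 3 by fastforce
  qed
qed simp

text \<open>An inversion is created in a single round, the one that separates \<open>v\<close> from
  \<open>u\<close>. It is enough that for every pivot one of the two items, not itself the pivot, is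
  hard to misplace. Each level of recursion then adds at most \<beta>; the assumption is inherited
  because sublists contain only former entries.\<close>

lemma prob_inversion_le:
  assumes "distinct xs" "length xs \<le> k" "u \<noteq> v" "0 \<le> \<beta>"
    and "\<And>p. p \<in> set xs \<Longrightarrow>
       (p \<noteq> v \<and> measure_pmf.prob (cmp_less e n v p) {c. c} \<le> \<beta>) \<or>
       (p \<noteq> u \<and> measure_pmf.prob (cmp_less e n u p) {c. \<not> c} \<le> \<beta>)"
  shows "measure_pmf.prob (qs_fuel e n k xs) {out. occurs_before out v u} \<le> real k * \<beta>"
  using assms(1,2,5)
proof (induction k arbitrary: xs)
  case (Suc k)
  let ?E = "{out. occurs_before out v u}"
  show ?case
  proof (cases "xs = []")
    case True
    then show ?thesis using \<open>0 \<le> \<beta>\<close> by simp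
  next
    case False
    have "measure_pmf.prob (qs_partition e n p (filter (\<lambda>x. x \<noteq> p) xs) \<bind> (\<lambda>(L, R).
            qs_fuel e n k L \<bind> (\<lambda>sL. qs_fuel e n k R \<bind> (\<lambda>sR. return_pmf (sL @ [p] @ sR))))) ?E
          \<le> real (Suc k) * \<beta>" if p: "p \<in> set xs" for p
    proof -
      define ys where "ys = filter (\<lambda>x. x \<noteq> p) xs"
      have ys: "distinct ys" "set ys = set xs - {p}" "length ys \<le> k"
        using Suc.prems(1,2) p length_filter_less[of p xs "\<lambda>x. x \<noteq> p"] by (auto simp: ys_def)
      \<comment> \<open>This round decides the pair wrongly, an item that is the pivot counting as
        misplaced. If \<open>bad\<close> fails, an inversion in the output must lie inside the
        sorted left part when \<open>v\<close> went left, and inside the sorted right part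
        otherwise.\<close>
      define bad where "bad = (\<lambda>LR :: nat list \<times> nat list.
         (v = p \<or> v \<in> set (fst LR)) \<and> (u = p \<or> u \<in> set (snd LR)))"
      have "measure_pmf.prob (qs_partition e n p ys \<bind> (\<lambda>(L, R).
            qs_fuel e n k L \<bind> (\<lambda>sL. qs_fuel e n k R \<bind> (\<lambda>sR. return_pmf (sL @ [p] @ sR))))) ?E
          \<le> 1 * measure_pmf.prob (qs_partition e n p ys) {LR. bad LR} + real k * \<beta>"
      proof (rule prob_bind_pmf_le)
        fix LR assume LR0: "LR \<in> set_pmf (qs_partition e n p ys)"
        obtain L R where LR: "LR = (L, R)" by force
        have ms: "mset L + mset R = mset ys"
          using qs_partition_support LR0 LR by blast
        then have st: "set L \<union> set R = set ys" by (metis set_mset_mset set_mset_union)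
        have "mset (L @ R) = mset ys" using ms by simp
        then have di: "distinct (L @ R)" using ys(1) by (metis distinct_count_atmost_1 set_mset_mset)
        have len: "length L \<le> k" "length R \<le> k"
          using arg_cong[OF ms, of size] ys(3) by auto
        have IHL: "measure_pmf.prob (qs_fuel e n k L) ?E \<le> real k * \<beta>"
          using st ys(2) di len Suc.prems(3) by (intro Suc.IH) auto
        have IHR: "measure_pmf.prob (qs_fuel e n k R) ?E \<le> real k * \<beta>"
          using st ys(2) di len Suc.prems(3) by (intro Suc.IH) auto
        have "measure_pmf.prob (qs_fuel e n k L \<bind> (\<lambda>sL. qs_fuel e n k R \<bind>
                (\<lambda>sR. return_pmf (sL @ [p] @ sR)))) ?E \<le> real k * \<beta>" if nb: "\<not> bad (L, R)"
        proof (cases "v \<in> set L")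
          case True
          have "measure_pmf.prob (qs_fuel e n k L \<bind> (\<lambda>sL. qs_fuel e n k R \<bind>
                (\<lambda>sR. return_pmf (sL @ [p] @ sR)))) ?E
             \<le> 1 * measure_pmf.prob (qs_fuel e n k L) {out. occurs_before out v u} + 0"
          proof (rule prob_bind_pmf_le, rule prob_bind_pmf_le_const)
            fix sL sR assume "sL \<in> set_pmf (qs_fuel e n k L)" "sR \<in> set_pmf (qs_fuel e n k R)"
            then have "set sL = set L" "set sR = set R" using qs_fuel_support by blast+
            then show "measure_pmf.prob (return_pmf (sL @ [p] @ sR)) ?E
              \<le> (if occurs_before sL v u then 1 else 0) + 0"
              using nb True di st ys(2) assms(3) occurs_before_in_set[of sR v u]
              by (auto simp: occurs_before_append occurs_before_Cons bad_def indicator_def)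
          qed
          then show ?thesis using IHL by simp
        next
          case False
          show ?thesis
          proof (rule prob_bind_pmf_le_const)
            fix sL assume sL: "sL \<in> set_pmf (qs_fuel e n k L)"
            have "measure_pmf.prob (qs_fuel e n k R \<bind> (\<lambda>sR. return_pmf (sL @ [p] @ sR))) ?E
               \<le> 1 * measure_pmf.prob (qs_fuel e n k R) {out. occurs_before out v u} + 0"
            proof (rule prob_bind_pmf_le)
              fix sR assume "sR \<in> set_pmf (qs_fuel e n k R)"
              then have "set sL = set L" "set sR = set R" using qs_fuel_support sL by blast+
              then show "measure_pmf.prob (return_pmf (sL @ [p] @ sR)) ?E
                \<le> (if occurs_before sR v u then 1 else 0) + 0"
                using nb False di st ys(2) assms(3) occurs_before_in_set[of sL v u]
                by (auto simp: occurs_before_append occurs_before_Cons bad_def indicator_def)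
            qed
            then show "measure_pmf.prob (qs_fuel e n k R \<bind> (\<lambda>sR. return_pmf (sL @ [p] @ sR))) ?E
               \<le> real k * \<beta>" using IHR by simp
          qed
        qed
        moreover have "0 \<le> real k * \<beta>" using \<open>0 \<le> \<beta>\<close> by simp
        ultimately show "measure_pmf.prob (case LR of (L, R) \<Rightarrow>
            qs_fuel e n k L \<bind> (\<lambda>sL. qs_fuel e n k R \<bind> (\<lambda>sR. return_pmf (sL @ [p] @ sR)))) ?E
            \<le> (if bad LR then 1 else 0) + real k * \<beta>"
          using LR by (auto intro: order_trans[OF measure_pmf.prob_le_1])
      qed
      moreover have "measure_pmf.prob (qs_partition e n p ys) {LR. bad LR} \<le> \<beta>"
        using Suc.prems(3)[OF p]
      proof (elim disjE conjE)
        assume "p \<noteq> v" and b: "measure_pmf.prob (cmp_less e n v p) {c. c} \<le> \<beta>"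
        then have "measure_pmf.prob (qs_partition e n p ys) {LR. bad LR} \<le>
          measure_pmf.prob (qs_partition e n p ys) {LR. v \<in> set (fst LR)}"
          by (intro measure_pmf.finite_measure_mono) (auto simp: bad_def)
        also have "\<dots> \<le> \<beta>" using b prob_qs_partition_side_le[OF ys(1), of e n p v True] by simp
        finally show ?thesis .
      next
        assume "p \<noteq> u" and b: "measure_pmf.prob (cmp_less e n u p) {c. \<not> c} \<le> \<beta>"
        then have "measure_pmf.prob (qs_partition e n p ys) {LR. bad LR} \<le>
          measure_pmf.prob (qs_partition e n p ys) {LR. u \<in> set (snd LR)}"
          by (intro measure_pmf.finite_measure_mono) (auto simp: bad_def)
        also have "\<dots> \<le> \<beta>" using b prob_qs_partition_side_le[OF ys(1), of e n p u False] by simp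
        finally show ?thesis .
      qed
      ultimately show ?thesis by (simp add: ys_def algebra_simps)
    qed
    then show ?thesis using False
      by (simp del: append.simps of_nat_Suc) (rule prob_bind_pmf_le_const, simp)
  qed
qed auto

text \<open>Only the first, uniformly chosen pivot is exploited. If it is some \<open>w\<close> in
  \<open>W\<close>, sends \<open>u\<close> right and \<open>v\<close> left, no later round can
  repair the order. The factor 1 stands for the pivot \<open>v\<close> itself, which needs no
  comparison.\<close>

lemma prob_inversion_ge:
  assumes "distinct xs" "u \<in> set xs" "v \<in> set xs" "u \<noteq> v" "W \<subseteq> set xs" "u \<notin> W"
    and W: "\<And>w. w \<in> W \<Longrightarrow> q \<le> measure_pmf.prob (cmp_less e n u w) {c. \<not> c} *
        (if w = v then 1 else measure_pmf.prob (cmp_less e n v w) {c. c})"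
  shows "q * real (card W) / real (length xs)
    \<le> measure_pmf.prob (quicksort e n xs) {out. occurs_before out v u}"
proof -
  let ?E = "{out. occurs_before out v u}"
  have ne: "xs \<noteq> []" using assms(2) by auto
  then obtain k where k: "length xs = Suc k" by (cases xs) auto
  have step: "q \<le> measure_pmf.prob (qs_partition e n p (filter (\<lambda>x. x \<noteq> p) xs) \<bind> (\<lambda>(L, R).
            qs_fuel e n k L \<bind> (\<lambda>sL. qs_fuel e n k R \<bind> (\<lambda>sR. return_pmf (sL @ [p] @ sR))))) ?E"
    if p: "p \<in> W" for p
  proof -
    define ys where "ys = filter (\<lambda>x. x \<noteq> p) xs"
    have u: "u \<in> set ys" using assms p by (auto simp: ys_def)
    define P where "P = (\<lambda>LR :: nat list \<times> nat list. (v = p \<or> v \<in> set (fst LR)) \<and> u \<in> set (snd LR))"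
    have "q \<le> measure_pmf.prob (qs_partition e n p ys) {LR. P LR}"
    proof (cases "p = v")
      case True
      then show ?thesis using W[OF p] prob_qs_partition_side_ge[OF u, of e n p False]
        by (simp add: P_def)
    next
      case False
      then have v: "v \<in> set ys" using assms by (auto simp: ys_def)
      have "{LR :: nat list \<times> nat list. P LR} = {LR. u \<in> set (snd LR) \<and> v \<in> set (fst LR)}"
        using False by (auto simp: P_def)
      then show ?thesis
        using W[OF p] False prob_qs_partition_sides_ge[OF u v assms(4), of e n p] by simp
    qed
    also have "1 * measure_pmf.prob (qs_partition e n p ys) {LR. P LR}
      \<le> measure_pmf.prob (qs_partition e n p ys \<bind> (\<lambda>(L, R).
            qs_fuel e n k L \<bind> (\<lambda>sL. qs_fuel e n k R \<bind> (\<lambda>sR. return_pmf (sL @ [p] @ sR))))) ?E"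
    proof (rule prob_bind_pmf_ge)
      fix LR assume P: "P LR"
      obtain L R where LR: "LR = (L, R)" by force
      have "1 \<le> measure_pmf.prob (qs_fuel e n k L \<bind> (\<lambda>sL. qs_fuel e n k R \<bind>
          (\<lambda>sR. return_pmf (sL @ [p] @ sR)))) ?E"
      proof (intro prob_bind_pmf_ge_const)
        fix sL sR assume "sL \<in> set_pmf (qs_fuel e n k L)" "sR \<in> set_pmf (qs_fuel e n k R)"
        then have "set sL = set L" "set sR = set R" using qs_fuel_support by blast+
        then show "1 \<le> measure_pmf.prob (return_pmf (sL @ [p] @ sR)) ?E"
          using P LR by (auto simp: occurs_before_append occurs_before_Cons P_def)
      qed
      then show "1 \<le> measure_pmf.prob (case LR of (L, R) \<Rightarrow>
            qs_fuel e n k L \<bind> (\<lambda>sL. qs_fuel e n k R \<bind> (\<lambda>sR. return_pmf (sL @ [p] @ sR)))) ?E"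
        by (simp add: LR)
    qed
    finally show ?thesis by (simp add: ys_def)
  qed
  have "q * measure_pmf.prob (pmf_of_set (set xs)) {p. p \<in> W}
    \<le> measure_pmf.prob (quicksort e n xs) ?E"
    unfolding quicksort_def k qs_fuel.simps if_not_P[OF ne]
    by (rule prob_bind_pmf_ge) (rule step)
  moreover have "measure_pmf.prob (pmf_of_set (set xs)) {p. p \<in> W} = real (card W) / real (length xs)"
    using assms ne by (subst measure_pmf_of_set) (auto simp: distinct_card Int_absorb1)
  ultimately show ?thesis by simp
qed

subsection \<open>Errors of a single comparison\<close>

lemma noisy_read_less: "r \<in> set_pmf (noisy_read e n u) \<Longrightarrow> r < 2 ^ n"
  by (induction n arbitrary: r) (fastforce split: if_splits)+

lemma mod_pow2_Suc: "(x::nat) mod 2 ^ Suc n = x mod 2 ^ n + (if bit x n then 2 ^ n else 0)"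
  by (simp add: power_Suc2 mod_mult2_eq bit_iff_odd mod_2_eq_odd del: power_Suc)

lemma prob_pair_pmf_fst: "measure_pmf.prob (pair_pmf M N) {z. P (fst z)} = measure_pmf.prob M {x. P x}"
  using measure_map_pmf[of fst "pair_pmf M N" "{x. P x}"] by (simp add: vimage_def map_fst_pair_pmf)

lemma prob_pair_pmf_snd: "measure_pmf.prob (pair_pmf M N) {z. P (snd z)} = measure_pmf.prob N {x. P x}"
  using measure_map_pmf[of snd "pair_pmf M N" "{x. P x}"] by (simp add: vimage_def map_snd_pair_pmf)

text \<open>Flips of the lowest j bits move the read by less than 2^j, so a deviation of
  \<open>t\<close> needs a flip of some bit j with 2^j > \<open>t\<close>. The probabilities 2^-j of
  these flips form a geometric series with sum at most 2/t - 2^-n; keeping the negative term makes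
  the induction close.\<close>

lemma noisy_read_e_a_tail:
  assumes "0 < t"
  shows "measure_pmf.prob (noisy_read e_a n x) {a. t \<le> \<bar>real a - real (x mod 2 ^ n)\<bar>}
     \<le> (if 2 ^ n \<le> t then 0 else 2 / t - 1 / 2 ^ n)"
proof (induction n)
  case 0
  then show ?case using assms by (auto simp: field_simps)
next
  case (Suc n)
  let ?F = "\<lambda>n. measure_pmf.prob (noisy_read e_a n x) {a. t \<le> \<bar>real a - real (x mod 2 ^ n)\<bar>}"
  show ?case
  proof (cases "2 ^ Suc n \<le> t")
    case True
    have "\<bar>real a - real (x mod 2 ^ Suc n)\<bar> < t" if "a \<in> set_pmf (noisy_read e_a (Suc n) x)" for a
    proof -
      have "a < 2 ^ Suc n" "x mod 2 ^ Suc n < 2 ^ Suc n" using noisy_read_less[OF that] by auto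
      then have "real a < real (2 ^ Suc n)" "real (x mod 2 ^ Suc n) < real (2 ^ Suc n)"
        unfolding of_nat_less_iff by auto
      then show ?thesis using True by auto
    qed
    then have "?F (Suc n) = 0"
      by (subst measure_pmf_zero_iff) fastforce
    then show ?thesis using True by simp
  next
    case False
    define q :: real where "q = 2 powr (- e_a (Suc n))"
    have "q = 1 / 2 ^ Suc n"
      by (simp add: q_def e_a_def powr_minus_divide powr_realpow del: of_nat_Suc power_Suc)
    then have q: "q = 1 / 2 ^ Suc n" "0 \<le> q" "q \<le> 1"
      using one_le_power[of "2::real" "Suc n"] by (auto simp del: power_Suc)
    have "?F (Suc n) \<le> 1 * ?F n + q"
      unfolding noisy_read.simps q_def[symmetric]
    proof (rule prob_bind_pmf_le)
      fix r :: nat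
      let ?M = "bernoulli_pmf q \<bind> (\<lambda>f. return_pmf (r + (if bit x n \<noteq> f then 2 ^ n else 0)))"
      let ?A = "{a. t \<le> \<bar>real a - real (x mod 2 ^ Suc n)\<bar>}"
      have "measure_pmf.prob ?M ?A \<le> q" if "\<not> t \<le> \<bar>real r - real (x mod 2 ^ n)\<bar>"
      proof -
        have "measure_pmf.prob ?M ?A \<le> 1 * measure_pmf.prob (bernoulli_pmf q) {f. f} + 0"
          by (rule prob_bind_pmf_le) (use that in \<open>auto simp: mod_pow2_Suc simp del: power_Suc\<close>)
        then show ?thesis using prob_bernoulli_pmf[OF q(2,3)] by simp
      qed
      then show "measure_pmf.prob ?M ?A \<le> (if t \<le> \<bar>real r - real (x mod 2 ^ n)\<bar> then 1 else 0) + q"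
        using q by (auto intro: order_trans[OF measure_pmf.prob_le_1])
    qed
    \<comment> \<open>If 2^n \<le> \<open>t\<close> < 2^(n+1), the new bit is the first that
      matters: the lower bits contribute 0, and \<open>q\<close> \<le> 1/t gives \<open>q\<close>
      \<le> 2/t - \<open>q\<close>. Afterwards 2/t - 2^-n + \<open>q\<close> equals 2/t -
      \<open>q\<close>, as 2^-n = 2 \<open>q\<close>.\<close>
    also have "\<dots> \<le> 2 / t - 1 / 2 ^ Suc n"
    proof (cases "2 ^ n \<le> t")
      case True
      have "1 / 2 ^ Suc n \<le> 1 / t" using False assms by (intro divide_left_mono) auto
      then show ?thesis using Suc True q by simp
    next
      case 2: False
      then show ?thesis using Suc q by (simp add: field_simps)
    qed
    finally show ?thesis using False by simp
  qed
qed

text \<open>The first item is meant to be the larger one, and ties count as errors. As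
  \<open>cmp_less\<close> answers False on equal reads, this is the exact error probability when the
  larger item is the second operand of \<open>cmp_less\<close>, and an upper bound when it is the
  first.\<close>

definition read_err :: "(nat \<Rightarrow> real) \<Rightarrow> nat \<Rightarrow> nat \<Rightarrow> nat \<Rightarrow> real" where
  "read_err e n x y =
     measure_pmf.prob (pair_pmf (noisy_read e n x) (noisy_read e n y)) {(a, b). a \<le> b}"

lemma cmp_less_eq_map_pair:
  "cmp_less e n x p = map_pmf (\<lambda>(a, b). a < b) (pair_pmf (noisy_read e n x) (noisy_read e n p))"
  by (simp add: cmp_less_def pair_pmf_def map_bind_pmf bind_return_pmf)

lemma prob_cmp_less_True_le: "measure_pmf.prob (cmp_less e n x p) {c. c} \<le> read_err e n x p"
  unfolding cmp_less_eq_map_pair measure_map_pmf read_err_def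
  by (rule measure_pmf.finite_measure_mono) auto

lemma prob_cmp_less_False_eq: "measure_pmf.prob (cmp_less e n x p) {c. \<not> c} = read_err e n p x"
  unfolding cmp_less_eq_map_pair read_err_def
  by (subst pair_commute_pmf) (auto simp: measure_map_pmf intro!: arg_cong[where f="measure_pmf.prob _"])

text \<open>If the reads are not in the right order, one of them is off by at least half the
  difference. Two tails of 2/t with t = (x - y)/2 add up to 8/(x - y).\<close>

lemma read_err_e_a_le:
  assumes "y < x" "x < 2 ^ n"
  shows "read_err e_a n x y \<le> 8 / (real x - real y)"
proof -
  define t where "t = (real x - real y) / 2"
  have t: "0 < t" using assms by (simp add: t_def)
  let ?M = "pair_pmf (noisy_read e_a n x) (noisy_read e_a n y)"
  have tail: "measure_pmf.prob (noisy_read e_a n z) {a. t \<le> \<bar>real a - real z\<bar>} \<le> 2 / t"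
    if "z < 2 ^ n" for z
  proof -
    have "(if 2 ^ n \<le> t then 0 else 2 / t - 1 / 2 ^ n) \<le> 2 / t" using t by simp
    then show ?thesis using noisy_read_e_a_tail[OF t, of n z] that by simp
  qed
  have "read_err e_a n x y \<le> measure_pmf.prob ?M
      ({z. t \<le> \<bar>real (fst z) - real x\<bar>} \<union> {z. t \<le> \<bar>real (snd z) - real y\<bar>})"
    unfolding read_err_def
  proof (rule measure_pmf.finite_measure_mono)
    have "t \<le> \<bar>real a - real x\<bar> \<or> t \<le> \<bar>real b - real y\<bar>" if "a \<le> b" for a b
    proof (rule ccontr)
      assume "\<not> ?thesis"
      then have "\<bar>real a - real x\<bar> < t" "\<bar>real b - real y\<bar> < t" by auto
      then show False using of_nat_mono[OF that, where 'a=real] unfolding t_def abs_less_iff by argo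
    qed
    then show "{(a, b). a \<le> b} \<subseteq> {z. t \<le> \<bar>real (fst z) - real x\<bar>} \<union> {z. t \<le> \<bar>real (snd z) - real y\<bar>}"
      by fastforce
  qed simp
  also have "\<dots> \<le> measure_pmf.prob ?M {z. t \<le> \<bar>real (fst z) - real x\<bar>}
      + measure_pmf.prob ?M {z. t \<le> \<bar>real (snd z) - real y\<bar>}"
    by (rule measure_Un_le) auto
  also have "\<dots> \<le> 2 / t + 2 / t"
    using tail[of x] tail[of y] assms
    by (intro add_mono) (simp_all add: prob_pair_pmf_fst[where P="\<lambda>a. t \<le> \<bar>real a - real x\<bar>"]
        prob_pair_pmf_snd[where P="\<lambda>a. t \<le> \<bar>real a - real y\<bar>"])
  also have "\<dots> = 8 / (real x - real y)" using t by (simp add: t_def)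
  finally show ?thesis .
qed

section \<open>Lower bounds on errors when all bits have the same flip probability\<close>

lemma prob_noisy_read_top_ge:
  assumes e: "\<And>j. 2 powr (- e j) = q" "q \<le> 1"
  shows "(if s then q else 1 - q) * (1 - q) ^ m \<le> measure_pmf.prob (noisy_read e (Suc m) u)
           {a. a = u mod 2 ^ m + (if bit u m \<noteq> s then 2 ^ m else 0)}"
proof -
  have q0: "0 \<le> q" using e(1)[of 0] by auto
  \<comment> \<open>\<open>s\<close> says whether the top bit is flipped. Bits are numbered from 0
    in \<open>bit u m\<close>, so this is the last bit that \<open>noisy_read\<close> treats. All
    lower bits are to be read correctly.\<close>
  have top: "(if s then q else 1 - q) * measure_pmf.prob (noisy_read e m u) {a. a = u mod 2 ^ m}
     \<le> measure_pmf.prob (noisy_read e (Suc m) u)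
           {a. a = u mod 2 ^ m + (if bit u m \<noteq> s then 2 ^ m else 0)}" for m s
    unfolding noisy_read.simps e
  proof (rule prob_bind_pmf_ge)
    fix r assume r: "r = u mod 2 ^ m"
    have "1 * measure_pmf.prob (bernoulli_pmf q) {f. f = s}
      \<le> measure_pmf.prob (bernoulli_pmf q \<bind> (\<lambda>f. return_pmf (r + (if bit u m \<noteq> f then 2 ^ m else 0))))
            {a. a = u mod 2 ^ m + (if bit u m \<noteq> s then 2 ^ m else 0)}"
      by (rule prob_bind_pmf_ge) (auto simp: r)
    then show "(if s then q else 1 - q)
      \<le> measure_pmf.prob (bernoulli_pmf q \<bind> (\<lambda>f. return_pmf (r + (if bit u m \<noteq> f then 2 ^ m else 0))))
            {a. a = u mod 2 ^ m + (if bit u m \<noteq> s then 2 ^ m else 0)}"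
      using prob_bernoulli_pmf[OF q0 e(2)] by (cases s) auto
  qed
  have "(1 - q) ^ m \<le> measure_pmf.prob (noisy_read e m u) {a. a = u mod 2 ^ m}"
  proof (induction m)
    case (Suc m)
    have "(1 - q) ^ Suc m \<le> (1 - q) * measure_pmf.prob (noisy_read e m u) {a. a = u mod 2 ^ m}"
      using Suc e(2) by (simp add: mult_left_mono)
    also have "\<dots> \<le> measure_pmf.prob (noisy_read e (Suc m) u) {a. a = u mod 2 ^ Suc m}"
      using top[of False m] by (simp add: mod_pow2_Suc del: power_Suc)
    finally show ?case .
  qed simp
  then have "(if s then q else 1 - q) * (1 - q) ^ m
      \<le> (if s then q else 1 - q) * measure_pmf.prob (noisy_read e m u) {a. a = u mod 2 ^ m}"
    using e(2) q0 by (intro mult_left_mono) auto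
  then show ?thesis using top[of s m] by linarith
qed

lemma bit_top_iff:
  assumes "(u::nat) < 2 ^ Suc m"
  shows "bit u m \<longleftrightarrow> 2 ^ m \<le> u"
proof -
  have "u div 2 ^ m < 2" using assms by (simp add: div_less_iff_less_mult)
  moreover have "2 ^ m \<le> u \<longleftrightarrow> 1 \<le> u div 2 ^ m" by (simp add: less_eq_div_iff_mult_less_eq)
  ultimately show ?thesis by (auto simp: bit_iff_odd less_2_cases_iff)
qed

lemma prob_cmp_less_top_ge:
  fixes u w m :: nat and s t :: bool
  defines "a \<equiv> u mod 2 ^ m + (if bit u m \<noteq> s then 2 ^ m else 0)"
    and "b \<equiv> w mod 2 ^ m + (if bit w m \<noteq> t then 2 ^ m else 0)"
  assumes e: "\<And>j. 2 powr (- e j) = q" "q \<le> 1"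
  shows "(if s then q else 1 - q) * (1 - q) ^ m * ((if t then q else 1 - q) * (1 - q) ^ m)
    \<le> measure_pmf.prob (cmp_less e (Suc m) u w) {c. c = (a < b)}"
proof -
  have q0: "0 \<le> q" using e(1)[of 0] by auto
  have "(if s then q else 1 - q) * (1 - q) ^ m * ((if t then q else 1 - q) * (1 - q) ^ m)
    \<le> measure_pmf.prob (noisy_read e (Suc m) u) {r. r = a} *
      measure_pmf.prob (noisy_read e (Suc m) w) {r. r = b}"
    unfolding a_def b_def
    using prob_noisy_read_top_ge[of e q s m u, OF e] prob_noisy_read_top_ge[of e q t m w, OF e] q0 e(2)
    by (intro mult_mono) auto
  also have "\<dots> = measure_pmf.prob (noisy_read e (Suc m) w) {r. r = b} *
      measure_pmf.prob (noisy_read e (Suc m) u) {r. r = a}" by simp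
  also have "\<dots> \<le> measure_pmf.prob (cmp_less e (Suc m) u w) {c. c = (a < b)}"
    unfolding cmp_less_def
  proof (rule prob_bind_pmf_ge)
    fix r assume r: "r = a"
    have "1 * measure_pmf.prob (noisy_read e (Suc m) w) {r. r = b} \<le> measure_pmf.prob
          (noisy_read e (Suc m) w \<bind> (\<lambda>b. return_pmf (r < b))) {c. c = (a < b)}"
      by (rule prob_bind_pmf_ge) (simp add: r)
    then show "measure_pmf.prob (noisy_read e (Suc m) w) {r. r = b} \<le> measure_pmf.prob
          (noisy_read e (Suc m) w \<bind> (\<lambda>b. return_pmf (r < b))) {c. c = (a < b)}" by simp
  qed
  finally show ?thesis .
qed

lemma low_bits_eq:
  assumes "(u::nat) < 2 ^ Suc m"
  shows "u mod 2 ^ m = (if 2 ^ m \<le> u then u - 2 ^ m else u)"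
  using assms by (auto simp: le_mod_geq)

context
  fixes e :: "nat \<Rightarrow> real" and q :: real and m :: nat
  assumes e: "\<And>j. 2 powr (- e j) = q" and q: "4 * real (Suc m) * q \<le> 1"
begin

lemma flip_prob_nonneg: "0 \<le> q" using e[of 0] by auto

lemma flip_prob_le: "q \<le> 1 / 4"
proof -
  have "1 * q \<le> real (Suc m) * q" using flip_prob_nonneg by (intro mult_right_mono) auto
  then show ?thesis using q by linarith
qed

text \<open>Two items have 2 * \<open>Suc m\<close> bits in all. By Bernoulli's inequality all of
  them are read correctly with probability at least 1 - 2 (m + 1) q, which is at least 1/2.\<close>

lemma no_flip_prob_ge:
  assumes "i \<le> 2 * Suc m"
  shows "1 / 2 \<le> (1 - q) ^ i"
proof -
  have "1 + real (2 * Suc m) * (- q) \<le> (1 + (- q)) ^ (2 * Suc m)"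
    by (rule Bernoulli_inequality) (use flip_prob_le in simp)
  moreover have "(1 - q) ^ (2 * Suc m) \<le> (1 - q) ^ i"
    using assms flip_prob_nonneg flip_prob_le by (intro power_decreasing) auto
  ultimately show ?thesis using q by (simp add: algebra_simps)
qed

lemma prob_top_flips_ge:
  "(if s then q else 1) * (if t then q else 1) / 2
    \<le> (if s then q else 1 - q) * (1 - q) ^ m * ((if t then q else 1 - q) * (1 - q) ^ m)"
proof -
  have *: "(if s then q else 1 - q) * (1 - q) ^ m = (if s then q else 1) * (1 - q) ^ (if s then m else Suc m)"
    for s by auto
  have "(if s then q else 1) * (if t then q else 1) * (1 / 2) \<le> (if s then q else 1) * (if t then q else 1) *
     (1 - q) ^ ((if s then m else Suc m) + (if t then m else Suc m))"
    using flip_prob_nonneg by (intro mult_left_mono no_flip_prob_ge) auto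
  then show ?thesis unfolding * by (simp add: power_add mult_ac)
qed

text \<open>\<open>r\<close> is the answer when the top bits are flipped as \<open>s\<close> and
  \<open>t\<close> prescribe and no other bit is. Each flip costs a factor \<open>q\<close>, all
  correct reads together a factor 1/2.\<close>

lemma prob_cmp_less_top_flips_ge:
  assumes "u < 2 ^ Suc m" "w < 2 ^ Suc m"
    and "r \<longleftrightarrow> u mod 2 ^ m + (if (2 ^ m \<le> u) \<noteq> s then 2 ^ m else 0)
         < w mod 2 ^ m + (if (2 ^ m \<le> w) \<noteq> t then 2 ^ m else 0)"
  shows "(if s then q else 1) * (if t then q else 1) / 2
    \<le> measure_pmf.prob (cmp_less e (Suc m) u w) {c. c = r}"
  using order_trans[OF prob_top_flips_ge[of s t] prob_cmp_less_top_ge[of e q s m t u w]] e flip_prob_le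
  unfolding assms(3) bit_top_iff[OF assms(1)] bit_top_iff[OF assms(2)] by simp

text \<open>With equal top bits one flip suffices: if both are 1, clear that of \<open>w\<close>; if
  both are 0, set that of \<open>u\<close>.\<close>

lemma prob_misplaced_same_top_ge:
  assumes "u < w" "w < 2 ^ Suc m" "2 ^ m \<le> u \<or> w < 2 ^ m"
  shows "q / 2 \<le> measure_pmf.prob (cmp_less e (Suc m) u w) {c. \<not> c}"
proof (cases "2 ^ m \<le> u")
  case True
  then show ?thesis
    using prob_cmp_less_top_flips_ge[of u w False False True] assms
      low_bits_eq[of u m] low_bits_eq[of w m] by simp
next
  case False
  then show ?thesis
    using prob_cmp_less_top_flips_ge[of u w False True False] assms by simp
qed

lemma prob_correct_ge:
  assumes "v < w" "w < 2 ^ Suc m"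
  shows "1 / 2 \<le> measure_pmf.prob (cmp_less e (Suc m) v w) {c. c}"
  using prob_cmp_less_top_flips_ge[of v w True False False] assms
      low_bits_eq[of v m] low_bits_eq[of w m] by auto

text \<open>Clearing the top bit of \<open>v\<close> leaves v - 2^m, which is below
  \<open>u\<close>.\<close>

lemma prob_misplaced_differing_top_ge:
  assumes "u < 2 ^ m" "2 ^ m \<le> v" "v < 2 ^ Suc m" "v < u + 2 ^ m"
  shows "q / 2 \<le> measure_pmf.prob (cmp_less e (Suc m) u v) {c. \<not> c}"
  using prob_cmp_less_top_flips_ge[of u v False False True] assms low_bits_eq[of v m] by simp

text \<open>Flipping both top bits reverses the order whatever the low parts are.\<close>

lemma prob_misplaced_two_flips_ge:
  assumes "u < 2 ^ m" "2 ^ m \<le> v" "v < 2 ^ Suc m"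
  shows "q\<^sup>2 / 2 \<le> measure_pmf.prob (cmp_less e (Suc m) u v) {c. \<not> c}"
  using prob_cmp_less_top_flips_ge[of u v False True True] assms low_bits_eq[of v m]
  by (simp add: power2_eq_square)

end

section \<open>Comparison errors under \<open>e_a\<close> across the two halves of the range\<close>

lemma flip_prob_e_a: "2 powr (- e_a n) = 1 / 2 ^ n"
  by (simp add: e_a_def powr_minus_divide powr_realpow)

text \<open>Here the top bits and the low parts are both in the right order. An error needs both top
  bits flipped, or one top flip together with low parts read in the wrong order. With q = 2^-(m+1)
  and d = v - 2^m - u this gives q^2 + 2q * 8/d.\<close>

lemma read_err_e_a_differing_top_le:
  assumes "u < 2 ^ m" "2 ^ m \<le> v" "v < 2 ^ Suc m" "u + 2 ^ m < v"
  shows "read_err e_a (Suc m) v u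
    \<le> 1 / 2 ^ Suc m * (16 / (real v - 2 ^ m - real u) + 1 / 2 ^ Suc m)"
proof -
  define q :: real where "q = 1 / 2 ^ Suc m"
  have q: "0 \<le> q" "q \<le> 1" using one_le_power[of "2::real" "Suc m"] by (auto simp: q_def simp del: power_Suc)
  \<comment> \<open>\<open>F\<close> adds the noisy top bits to the low reads, so that one can
    condition on the low reads of both items.\<close>
  define F where "F = (\<lambda>(a::nat, b::nat). bernoulli_pmf q \<bind> (\<lambda>f. bernoulli_pmf q \<bind>
    (\<lambda>g. return_pmf (a + (if \<not> f then 2 ^ m else 0), b + (if g then 2 ^ m else 0)))))"
  have bits: "bit v m" "\<not> bit u m" using assms bit_top_iff[of u m] bit_top_iff[of v m] by auto
  have "pair_pmf (noisy_read e_a (Suc m) v) (noisy_read e_a (Suc m) u)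
     = pair_pmf (noisy_read e_a m v) (noisy_read e_a m u) \<bind> F"
    by (simp add: pair_pmf_def bind_assoc_pmf bind_return_pmf F_def flip_prob_e_a bits q_def del: power_Suc)
      (rule bind_pmf_cong[OF refl], rule bind_commute_pmf)
  then have "read_err e_a (Suc m) v u = measure_pmf.prob
      (pair_pmf (noisy_read e_a m v) (noisy_read e_a m u) \<bind> F) {(a, b). a \<le> b}"
    by (simp add: read_err_def)
  also have "\<dots> \<le> (2 * q) * measure_pmf.prob (pair_pmf (noisy_read e_a m v) (noisy_read e_a m u))
      {z. fst z \<le> snd z} + q * q"
  proof (rule prob_bind_pmf_le)
    fix z assume "z \<in> set_pmf (pair_pmf (noisy_read e_a m v) (noisy_read e_a m u))"
    then obtain a b where z: "z = (a, b)" "a < 2 ^ m" "b < 2 ^ m"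
      using noisy_read_less by (cases z) auto
    let ?A = "{(a, b). a \<le> (b::nat)}"
    have T: "measure_pmf.prob (bernoulli_pmf q) {f. f} = q" using prob_bernoulli_pmf[OF q] by simp
    \<comment> \<open>If the low reads satisfy \<open>a\<close> \<le> \<open>b\<close>, some top
      flip is still needed, which costs at most 2q; if not, both top bits have to flip.\<close>
    show "measure_pmf.prob (F z) ?A \<le> (if fst z \<le> snd z then 2 * q else 0) + q * q"
    proof (cases "a \<le> b")
      case True
      have "measure_pmf.prob (F z) ?A \<le> 1 * measure_pmf.prob (bernoulli_pmf q) {f. f} + q"
        unfolding F_def z prod.case
      proof (rule prob_bind_pmf_le)
        fix f
        let ?M = "bernoulli_pmf q \<bind>
          (\<lambda>g. return_pmf (a + (if \<not> f then 2 ^ m else 0), b + (if g then 2 ^ m else 0)))"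
        have "measure_pmf.prob ?M ?A \<le> 1 * measure_pmf.prob (bernoulli_pmf q) {f. f} + 0" if "\<not> f"
          by (rule prob_bind_pmf_le) (use that z in \<open>auto simp: indicator_def\<close>)
        then show "measure_pmf.prob ?M ?A \<le> (if f then 1 else 0) + q"
          using T q by (auto intro: order_trans[OF measure_pmf.prob_le_1])
      qed
      then show ?thesis using True T z(1) mult_nonneg_nonneg[OF q(1) q(1)]
        by (simp del: mult_nonneg_nonneg zero_le_square)
    next
      case False
      have "measure_pmf.prob (F z) ?A \<le> q * measure_pmf.prob (bernoulli_pmf q) {f. f} + 0"
        unfolding F_def z prod.case
      proof (rule prob_bind_pmf_le)
        fix f
        let ?M = "bernoulli_pmf q \<bind>
          (\<lambda>g. return_pmf (a + (if \<not> f then 2 ^ m else 0), b + (if g then 2 ^ m else 0)))"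
        have "measure_pmf.prob ?M ?A \<le> 1 * measure_pmf.prob (bernoulli_pmf q) {g. g} + 0" if f
          by (rule prob_bind_pmf_le) (use that z False in \<open>auto simp: indicator_def\<close>)
        moreover have "measure_pmf.prob ?M ?A \<le> 0" if "\<not> f"
          by (rule prob_bind_pmf_le_const) (use that z False in \<open>auto simp: indicator_def\<close>)
        ultimately show "measure_pmf.prob ?M ?A \<le> (if f then q else 0) + 0" using T by simp
      qed
      then show ?thesis using False T z(1) by simp
    qed
  qed
  also have "\<dots> \<le> (2 * q) * (8 / (real v - 2 ^ m - real u)) + q * q"
  proof (intro add_right_mono mult_left_mono)
    \<comment> \<open>Reading only the \<open>m\<close> low bits cannot distinguish \<open>v\<close>
      from v - 2^m, so the general bound applies to the difference of the low parts.\<close>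
    have low: "noisy_read e_a k (x + 2 ^ m) = noisy_read e_a k x" if "k \<le> m" for k x
      using that
    proof (induction k)
      case (Suc k)
      obtain j where m: "m = Suc j + k" using Suc.prems by (metis add.commute add_Suc_shift le_Suc_ex)
      have "(x + 2 ^ m) div 2 ^ k = x div 2 ^ k + 2 ^ Suc j" by (simp only: m power_add) simp
      then have "bit (x + 2 ^ m) k = bit x k" by (simp add: bit_iff_odd)
      then show ?case using Suc by simp
    qed simp
    have "noisy_read e_a m v = noisy_read e_a m (v - 2 ^ m)"
      using low[of m "v - 2 ^ m"] assms by simp
    moreover have "{z. fst z \<le> snd z} = {(a, b). a \<le> (b::nat)}" by auto
    ultimately show "measure_pmf.prob (pair_pmf (noisy_read e_a m v) (noisy_read e_a m u))
        {z. fst z \<le> snd z} \<le> 8 / (real v - 2 ^ m - real u)"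
      using read_err_e_a_le[of u "v - 2 ^ m" m] assms by (simp add: read_err_def of_nat_diff)
  qed (use q in simp)
  also have "\<dots> = q * (16 / (real v - 2 ^ m - real u) + q)" by (simp add: distrib_left)
  finally show ?thesis unfolding q_def .
qed

text \<open>Every bit is flipped with probability strictly between 0 and 1, so both items may be
  read as 0, and a tie is answered by False.\<close>

lemma prob_cmp_less_e_a_False_pos: "0 < measure_pmf.prob (cmp_less e_a n u v) {c. \<not> c}"
proof -
  have zero: "0 \<in> set_pmf (noisy_read e_a n x)" for x
  proof (induction n)
    case (Suc n)
    have q: "0 < 1 / (2::real) ^ Suc n" "1 / (2::real) ^ Suc n < 1"
      using one_less_power[of "2::real" "Suc n"] by (auto simp del: power_Suc)
    show ?case unfolding noisy_read.simps flip_prob_e_a set_bind_pmf set_pmf_bernoulli[OF q]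
      by (intro UN_I[OF Suc] UN_I[of "bit x n"]) auto
  qed simp
  have "False \<in> set_pmf (cmp_less e_a n u v)"
    unfolding cmp_less_def set_bind_pmf by (intro UN_I[OF zero]) auto
  then show ?thesis by (intro measure_pmf_posI) auto
qed

subsection \<open>Pairs of entries\<close>

definition lt_pairs :: "nat set \<Rightarrow> (nat \<times> nat) set" where
  "lt_pairs S = {(u, v). u \<in> S \<and> v \<in> S \<and> u < v}"

lemma finite_lt_pairs [simp]: "finite S \<Longrightarrow> finite (lt_pairs S)"
  by (rule finite_subset[of _ "S \<times> S"]) (auto simp: lt_pairs_def)

lemma lt_pairs_mono: "S \<subseteq> T \<Longrightarrow> lt_pairs S \<subseteq> lt_pairs T"
  by (auto simp: lt_pairs_def)

lemma lt_pairs_insert_max: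
  assumes "\<forall>a\<in>A. a < b"
  shows "lt_pairs (insert b A) = lt_pairs A \<union> A \<times> {b}" "lt_pairs A \<inter> A \<times> {b} = {}"
  using assms by (auto simp: lt_pairs_def)

lemma card_lt_pairs:
  assumes "finite A"
  shows "2 * card (lt_pairs A) + card A = (card A)\<^sup>2"
  using assms
proof (induction rule: finite_linorder_max_induct)
  case empty
  then show ?case by (simp add: lt_pairs_def)
next
  case (insert b A)
  have "card (lt_pairs (insert b A)) = card (lt_pairs A) + card A"
    using insert lt_pairs_insert_max[of A b] by (simp add: card_Un_disjoint)
  moreover have "b \<notin> A" using insert by auto
  ultimately show ?case using insert by (simp add: power2_eq_square)
qed

text \<open>Counts the triples u < v \<le> w, of which there are k (k^2 - 1) / 6 for k =
  \<open>card A\<close>, in a form without subtraction. A new maximum extends every old pair by one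
  \<open>w\<close>, and each new pair has only that maximum as \<open>w\<close>.\<close>

lemma sum_card_above:
  assumes "finite A"
  shows "6 * (\<Sum>(u, v)\<in>lt_pairs A. card {w \<in> A. v \<le> w}) + card A = card A ^ 3"
  using assms
proof (induction rule: finite_linorder_max_induct)
  case empty
  then show ?case by (simp add: lt_pairs_def)
next
  case (insert b A)
  have nb: "b \<notin> A" using insert by auto
  have "(\<Sum>(u, v)\<in>lt_pairs (insert b A). card {w \<in> insert b A. v \<le> w})
    = (\<Sum>(u, v)\<in>lt_pairs A. card {w \<in> insert b A. v \<le> w})
      + (\<Sum>(u, v)\<in>A \<times> {b}. card {w \<in> insert b A. v \<le> w})"
    using insert lt_pairs_insert_max[of A b] by (simp add: sum.union_disjoint)
  also have "(\<Sum>(u, v)\<in>A \<times> {b}. card {w \<in> insert b A. v \<le> w}) = (\<Sum>z\<in>A \<times> {b}. 1)"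
  proof (rule sum.cong[OF refl], clarify)
    have "{w \<in> insert b A. b \<le> w} = {b}" using insert by auto
    then show "card {w \<in> insert b A. b \<le> w} = 1" by simp
  qed
  also have "(\<Sum>(u, v)\<in>lt_pairs A. card {w \<in> insert b A. v \<le> w})
      = (\<Sum>(u, v)\<in>lt_pairs A. card {w \<in> A. v \<le> w} + 1)"
  proof (rule sum.cong[OF refl], clarify)
    fix u v assume "(u, v) \<in> lt_pairs A"
    then have "{w \<in> insert b A. v \<le> w} = insert b {w \<in> A. v \<le> w}"
      using insert by (auto simp: lt_pairs_def intro: less_imp_le)
    then show "card {w \<in> insert b A. v \<le> w} = card {w \<in> A. v \<le> w} + 1"
      using insert nb by simp
  qed
  also have "\<dots> = (\<Sum>(u, v)\<in>lt_pairs A. card {w \<in> A. v \<le> w}) + card (lt_pairs A)"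
    by (simp add: case_prod_beta sum.distrib del: Suc_eq_plus1 One_nat_def add_Suc_right)
  finally show ?case using insert nb card_lt_pairs[of A]
    by (simp add: power2_eq_square power3_eq_cube algebra_simps)
qed

text \<open>Ordering the two values of an index pair is a bijection onto the increasing value pairs;
  symmetry of \<open>h\<close> absorbs the swaps.\<close>

lemma sum_index_pairs_eq_lt_pairs:
  fixes h :: "nat \<Rightarrow> nat \<Rightarrow> real"
  assumes "distinct C" and sym: "\<And>x y. h x y = h y x"
  shows "(\<Sum>a<length C. \<Sum>b\<in>{a<..<length C}. h (C ! a) (C ! b)) = (\<Sum>(u, v)\<in>lt_pairs (set C). h u v)"
proof -
  define A where "A = Sigma {..<length C} (\<lambda>a. {a<..<length C})"
  define g where "g = (\<lambda>(a, b). (min (C ! a) (C ! b), max (C ! a) (C ! b)))"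
  have nth: "C ! a = C ! b \<longleftrightarrow> a = b" if "a < length C" "b < length C" for a b
    using assms(1) that nth_eq_iff_index_eq by blast
  have inj: "inj_on g A"
    by (auto simp: inj_on_def A_def g_def min_def max_def nth split: if_splits)
  have "g ` A = lt_pairs (set C)"
  proof
    show "g ` A \<subseteq> lt_pairs (set C)"
      using nth by (fastforce simp: A_def g_def lt_pairs_def min_def max_def)
    show "lt_pairs (set C) \<subseteq> g ` A"
    proof clarify
      fix u v assume "(u, v) \<in> lt_pairs (set C)"
      then obtain a b where ab: "a < length C" "b < length C" "u = C ! a" "v = C ! b" "u < v"
        by (auto simp: lt_pairs_def in_set_conv_nth)
      then have "a \<noteq> b" by auto
      then have "(min a b, max a b) \<in> A" "g (min a b, max a b) = (u, v)"
        using ab by (auto simp: A_def g_def min_def max_def)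
      then show "(u, v) \<in> g ` A" by (metis image_eqI)
    qed
  qed
  then have "(\<Sum>(u, v)\<in>lt_pairs (set C). h u v) = (\<Sum>z\<in>A. case g z of (u, v) \<Rightarrow> h u v)"
    using sum.reindex[OF inj, of "\<lambda>(u, v). h u v"] by (simp add: o_def)
  also have "\<dots> = (\<Sum>(a, b)\<in>A. h (C ! a) (C ! b))"
    by (rule sum.cong) (auto simp: g_def min_def max_def sym)
  also have "\<dots> = (\<Sum>a<length C. \<Sum>b\<in>{a<..<length C}. h (C ! a) (C ! b))"
    unfolding A_def by (subst sum.Sigma) auto
  finally show ?thesis by simp
qed

lemma wkt_eq_sum_lt_pairs:
  assumes "distinct C"
  shows "wkt e n C = (\<Sum>(u, v)\<in>lt_pairs (set C). (real v - real u) *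
     measure_pmf.prob (quicksort e n C) {out. occurs_before out v u})"
proof -
  have "wkt e n C = (\<Sum>(u, v)\<in>lt_pairs (set C). \<bar>real u - real v\<bar> * prob_Q e n C u v)"
    unfolding wkt_def
  proof (rule sum_index_pairs_eq_lt_pairs[OF assms])
    show "\<bar>real x - real y\<bar> * prob_Q e n C x y = \<bar>real y - real x\<bar> * prob_Q e n C y x" for x y
      by (cases x y rule: linorder_cases) (auto simp: prob_Q_def)
  qed
  also have "\<dots> = (\<Sum>(u, v)\<in>lt_pairs (set C). (real v - real u) *
     measure_pmf.prob (quicksort e n C) {out. occurs_before out v u})"
    by (rule sum.cong) (auto simp: lt_pairs_def prob_Q_def)
  finally show ?thesis .
qed

section \<open>Double counting of pairs over all inputs\<close>

lemma finite_inputs [simp]: "finite (inputs N n)"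
proof (rule finite_subset)
  show "inputs N n \<subseteq> {C. set C \<subseteq> {..<2 ^ n} \<and> length C = N}" by (auto simp: inputs_def)
qed (rule finite_lists_length_eq, simp)

text \<open>A permutation of the values taking one pair to the other acts injectively on inputs.
  Used in both directions, it shows that all pairs of distinct values lie in equally many
  inputs.\<close>

lemma card_inputs_containing_le:
  assumes "x \<noteq> y" "x' \<noteq> y'" "x < 2 ^ n" "y < 2 ^ n" "x' < 2 ^ n" "y' < 2 ^ n"
  shows "card {C \<in> inputs N n. x \<in> set C \<and> y \<in> set C} \<le> card {C \<in> inputs N n. x' \<in> set C \<and> y' \<in> set C}"
proof -
  \<comment> \<open>First \<open>x\<close> goes to \<open>x'\<close>, then the current image of
    \<open>y\<close> goes to \<open>y'\<close>. That image is not \<open>x'\<close>, so the second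
    swap fixes \<open>x'\<close>.\<close>
  define \<pi> where "\<pi> = Transposition.transpose (Transposition.transpose x x' y) y' \<circ> Transposition.transpose x x'"
  have inj: "inj \<pi>" unfolding \<pi>_def by (intro inj_compose) auto
  have \<pi>: "\<pi> x = x'" "\<pi> y = y'" using assms by (auto simp: \<pi>_def Transposition.transpose_def)
  have bound: "\<pi> z < 2 ^ n" if "z < 2 ^ n" for z
    using assms that by (auto simp: \<pi>_def Transposition.transpose_def)
  show ?thesis
  proof (rule card_inj_on_le[where f="map \<pi>"])
    show "inj_on (map \<pi>) {C \<in> inputs N n. x \<in> set C \<and> y \<in> set C}"
      using inj by (meson inj_mapI inj_on_subset subset_UNIV)
    show "map \<pi> ` {C \<in> inputs N n. x \<in> set C \<and> y \<in> set C} \<subseteq> {C \<in> inputs N n. x' \<in> set C \<and> y' \<in> set C}"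
      using \<pi> bound inj_on_subset[OF inj subset_UNIV] by (auto simp: inputs_def distinct_map)
  qed simp
qed

text \<open>Every pair lies in the same number of inputs. Hence the expected number of pairs from
  \<open>Q\<close> in a random input is the share of \<open>Q\<close> among all pairs times the
  number of pairs in an input; here it is multiplied out.\<close>

lemma sum_inputs_card_pairs:
  assumes Q: "Q \<subseteq> lt_pairs {..<2 ^ n}"
  shows "(\<Sum>C\<in>inputs N n. card (Q \<inter> lt_pairs (set C))) * card (lt_pairs {..<2 ^ n})
    = card Q * (card (inputs N n) * card (lt_pairs {..<N}))"
proof -
  define K where "K = (\<lambda>(x, y). card {C \<in> inputs N n. x \<in> set C \<and> y \<in> set C})"
  have count: "(\<Sum>C\<in>inputs N n. card (P \<inter> lt_pairs (set C))) = (\<Sum>z\<in>P. K z)"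
    if P: "P \<subseteq> lt_pairs {..<2 ^ n}" for P
  proof -
    have fin: "finite P" using P by (rule finite_subset) simp
    have "(\<Sum>C\<in>inputs N n. card (P \<inter> lt_pairs (set C)))
       = (\<Sum>C\<in>inputs N n. \<Sum>z\<in>{z \<in> P. z \<in> lt_pairs (set C)}. 1)"
      by (simp add: Int_def)
    also have "\<dots> = (\<Sum>z\<in>P. \<Sum>C\<in>{C \<in> inputs N n. z \<in> lt_pairs (set C)}. 1)"
      by (rule sum.swap_restrict) (use fin in auto)
    also have "\<dots> = (\<Sum>z\<in>P. K z)"
    proof (rule sum.cong[OF refl])
      fix z assume "z \<in> P"
      then have "{C \<in> inputs N n. z \<in> lt_pairs (set C)} = {C \<in> inputs N n. fst z \<in> set C \<and> snd z \<in> set C}"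
        using P by (auto simp: lt_pairs_def)
      then show "(\<Sum>C\<in>{C \<in> inputs N n. z \<in> lt_pairs (set C)}. 1) = K z"
        by (simp add: K_def case_prod_beta)
    qed
    finally show ?thesis .
  qed
  have const: "K z = K z'" if "z \<in> lt_pairs {..<2 ^ n}" "z' \<in> lt_pairs {..<2 ^ n}" for z z'
    using that unfolding K_def lt_pairs_def
    by (auto intro!: antisym card_inputs_containing_le)
  have all: "(\<Sum>z\<in>lt_pairs {..<2 ^ n}. K z) = card (inputs N n) * card (lt_pairs {..<N})"
  proof -
    have "card (lt_pairs {..<2 ^ n} \<inter> lt_pairs (set C)) = card (lt_pairs {..<N})" if "C \<in> inputs N n" for C
    proof -
      have "lt_pairs {..<2 ^ n} \<inter> lt_pairs (set C) = lt_pairs (set C)"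
        using that lt_pairs_mono[of "set C" "{..<2 ^ n}"] by (auto simp: inputs_def)
      moreover have "card (set C) = N" using that by (auto simp: inputs_def distinct_card)
      ultimately show ?thesis using card_lt_pairs[of "set C"] card_lt_pairs[of "{..<N}"] by simp
    qed
    then show ?thesis using count[of "lt_pairs {..<2 ^ n}"] by simp
  qed
  show ?thesis
  proof (cases "Q = {}")
    case False
    then obtain z0 where z0: "z0 \<in> lt_pairs {..<2 ^ n}" using Q by auto
    have "(\<Sum>z\<in>Q. K z) = (\<Sum>z\<in>Q. K z0)" using const[OF _ z0] Q by (intro sum.cong) auto
    moreover have "(\<Sum>z\<in>lt_pairs {..<2 ^ n}. K z) = (\<Sum>z\<in>lt_pairs {..<2 ^ n}. K z0)"
      using const[OF _ z0] by (intro sum.cong) auto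
    ultimately show ?thesis using count[OF Q] all by simp
  qed simp
qed

text \<open>The second alternative says that the gap differs from 2^m by less than \<open>D\<close>.
  Avoiding it matters for two entries in different halves: if their low parts are in the same order,
  these are then at least \<open>D\<close> apart.\<close>

definition near_pairs :: "nat \<Rightarrow> nat \<Rightarrow> (nat \<times> nat) set" where
  "near_pairs m D = {(u, v). v < u + D \<or> (u + 2 ^ m < v + D \<and> v < u + 2 ^ m + D)}"

lemma card_near_pairs_le: "card (lt_pairs {..<V} \<inter> near_pairs m D) \<le> V * (3 * D)"
proof -
  \<comment> \<open>For a given \<open>u\<close> the two windows for \<open>v\<close> have fewer
    than \<open>D\<close> and fewer than 2 * \<open>D\<close> elements when \<open>D\<close> is
    positive; truncated subtraction can only shorten the second.\<close>
  let ?F = "\<lambda>u::nat. {u<..<u + D} \<union> {u + 2 ^ m + 1 - D..<u + 2 ^ m + D}"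
  have "lt_pairs {..<V} \<inter> near_pairs m D \<subseteq> Sigma {..<V} ?F"
    by (auto simp: lt_pairs_def near_pairs_def)
  then have "card (lt_pairs {..<V} \<inter> near_pairs m D) \<le> card (Sigma {..<V} ?F)"
    by (intro card_mono) auto
  also have "\<dots> = (\<Sum>u<V. card (?F u))" by simp
  also have "\<dots> \<le> (\<Sum>u<V. 3 * D)"
  proof (rule sum_mono)
    fix u
    have "card (?F u) \<le> card {u<..<u + D} + card {u + 2 ^ m + 1 - D..<u + 2 ^ m + D}"
      by (rule card_Un_le)
    also have "\<dots> \<le> 3 * D" by simp
    finally show "card (?F u) \<le> 3 * D" .
  qed
  finally show ?thesis by simp
qed

subsection \<open>Weighted inversions\<close>

text \<open>A pivot up to the midpoint of \<open>u\<close> and \<open>v\<close> is at least half the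
  gap away from \<open>v\<close>, any other pivot at least that far from \<open>u\<close>. So a
  round errs with probability at most \<beta> = 16/gap. The weight cancels the gap, leaving 16
  \<open>N\<close> for each pair.\<close>

lemma wkt_e_a_le:
  assumes C: "C \<in> inputs N n"
  shows "wkt e_a n C \<le> 8 * real N ^ 3"
proof -
  have C': "length C = N" "distinct C" "\<And>x. x \<in> set C \<Longrightarrow> x < 2 ^ n" using C by (auto simp: inputs_def)
  have "wkt e_a n C \<le> (\<Sum>z\<in>lt_pairs (set C). 16 * real N)"
    unfolding wkt_eq_sum_lt_pairs[OF C'(2)]
  proof (rule sum_mono, clarify)
    fix u v assume "(u, v) \<in> lt_pairs (set C)"
    then have uv: "u \<in> set C" "v \<in> set C" "u < v" by (auto simp: lt_pairs_def)
    define \<beta> where "\<beta> = 16 / (real v - real u)"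
    have "measure_pmf.prob (quicksort e_a n C) {out. occurs_before out v u} \<le> real (length C) * \<beta>"
      unfolding quicksort_def
    proof (rule prob_inversion_le[OF C'(2) order_refl])
      show "u \<noteq> v" "0 \<le> \<beta>" using uv by (auto simp: \<beta>_def)
      fix p assume p: "p \<in> set C"
      show "(p \<noteq> v \<and> measure_pmf.prob (cmp_less e_a n v p) {c. c} \<le> \<beta>) \<or>
       (p \<noteq> u \<and> measure_pmf.prob (cmp_less e_a n u p) {c. \<not> c} \<le> \<beta>)"
      proof (cases "2 * p \<le> u + v")
        case True
        then have r: "2 * real p \<le> real u + real v" by linarith
        have "p < v" using True uv by simp
        have "measure_pmf.prob (cmp_less e_a n v p) {c. c} \<le> 8 / (real v - real p)"
          using prob_cmp_less_True_le read_err_e_a_le[OF \<open>p < v\<close> C'(3)[OF uv(2)]] order_trans by blast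
        also have "\<dots> \<le> \<beta>" using r uv \<open>p < v\<close> by (simp add: \<beta>_def field_simps)
        finally show ?thesis using \<open>p < v\<close> by simp
      next
        case False
        then have r: "real u + real v \<le> 2 * real p" by linarith
        have "u < p" using False uv by simp
        have "measure_pmf.prob (cmp_less e_a n u p) {c. \<not> c} \<le> 8 / (real p - real u)"
          using prob_cmp_less_False_eq read_err_e_a_le[OF \<open>u < p\<close> C'(3)[OF p]] by simp
        also have "\<dots> \<le> \<beta>" using r uv \<open>u < p\<close> by (simp add: \<beta>_def field_simps)
        finally show ?thesis using \<open>u < p\<close> by simp
      qed
    qed
    then have "(real v - real u) * measure_pmf.prob (quicksort e_a n C) {out. occurs_before out v u}
      \<le> (real v - real u) * (real (length C) * \<beta>)"
      using uv by (intro mult_left_mono) auto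
    also have "\<dots> = 16 * real N" using uv C'(1) by (simp add: \<beta>_def)
    finally show "(real v - real u) * measure_pmf.prob (quicksort e_a n C) {out. occurs_before out v u}
      \<le> 16 * real N" .
  qed
  also have "\<dots> = 8 * real N * real (2 * card (lt_pairs (set C)))" by simp
  also have "\<dots> \<le> 8 * real N * real (N\<^sup>2)"
    using card_lt_pairs[of "set C"] C' by (intro mult_left_mono of_nat_mono) (auto simp: distinct_card)
  finally show ?thesis by (simp add: power2_eq_square power3_eq_cube)
qed

text \<open>Guards the quotient in \<open>good\<close>: a vanishing denominator would make it 0 by
  convention.\<close>

lemma wkt_e_a_pos:
  assumes C: "C \<in> inputs N n" and "2 \<le> N"
  shows "0 < wkt e_a n C"
proof -
  have C': "length C = N" "distinct C" using C by (auto simp: inputs_def)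
  have "(card (set C))\<^sup>2 \<noteq> card (set C)"
    using C' assms(2) by (auto simp: distinct_card power2_eq_square)
  then have "lt_pairs (set C) \<noteq> {}" using card_lt_pairs[of "set C"] by force
  then obtain u v where uv: "(u, v) \<in> lt_pairs (set C)" by auto
  then have uv': "u \<in> set C" "v \<in> set C" "u < v" by (auto simp: lt_pairs_def)
  show ?thesis unfolding wkt_eq_sum_lt_pairs[OF C'(2)]
  proof (rule sum_pos2[OF _ uv])
    have "0 < measure_pmf.prob (cmp_less e_a n u v) {c. \<not> c} * real (card {v}) / real (length C)"
      using prob_cmp_less_e_a_False_pos[of n u v] C' assms(2) by simp
    also have "\<dots> \<le> measure_pmf.prob (quicksort e_a n C) {out. occurs_before out v u}"
      by (rule prob_inversion_ge) (use uv' C' in auto)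
    finally show "0 < (case (u, v) of (u, v) \<Rightarrow> (real v - real u) *
        measure_pmf.prob (quicksort e_a n C) {out. occurs_before out v u})"
      using uv' by simp
    show "finite (lt_pairs (set C))" by simp
  qed (auto simp: lt_pairs_def)
qed

section \<open>Lower bound for the weighted inversions under \<open>e_o\<close>\<close>

lemma e_o_flip_prob_square: "(2 powr (- ((real n + 1) / 2)))\<^sup>2 = 1 / (2::real) ^ Suc n"
proof -
  have "(2 powr (- ((real n + 1) / 2)))\<^sup>2 = (2::real) powr (- real (Suc n))"
    unfolding power2_eq_square powr_add[symmetric] by (rule arg_cong[where f="(powr) 2"]) simp
  also have "\<dots> = 1 / 2 ^ Suc n" by (simp only: powr_minus_divide powr_realpow zero_less_numeral)
  finally show ?thesis .
qed

text \<open>Squared, the claim reads 16 n^2 \<le> 2^(n+1), which fails at n = 9 and holds from n =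
  10 on.\<close>

lemma e_o_flip_prob_small:
  assumes "10 \<le> n"
  shows "4 * real n * 2 powr (- ((real n + 1) / 2)) \<le> 1"
proof -
  have "16 * n\<^sup>2 \<le> 2 ^ Suc n" using assms
  proof (induction rule: nat_induct_at_least)
    case (Suc n)
    have "3 * n \<le> n * n" using Suc(1) by (intro mult_right_mono) auto
    then have "2 * n + 1 \<le> n * n" using Suc(1) by linarith
    then have "16 * (Suc n)\<^sup>2 \<le> 2 * (16 * n\<^sup>2)" by (simp add: power2_eq_square)
    then show ?case using Suc(2) by simp
  qed simp
  then have "real (16 * n\<^sup>2) \<le> real (2 ^ Suc n)" by (rule of_nat_mono)
  then have "16 * (real n)\<^sup>2 \<le> 2 ^ Suc n" by simp
  then have "(4 * real n * 2 powr (- ((real n + 1) / 2)))\<^sup>2 \<le> 1\<^sup>2"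
    by (simp add: power_mult_distrib e_o_flip_prob_square)
  then show ?thesis by (rule power2_le_imp_le) simp
qed

text \<open>Each \<open>w\<close> in \<open>H\<close> from \<open>v\<close> upwards is the first
  pivot with probability 1/N. Then \<open>u\<close> is misplaced with probability at least q/2,
  while \<open>v\<close> is the pivot or goes left with probability at least 1/2.\<close>

lemma wkt_e_o_ge_half:
  fixes m :: nat
  defines "q \<equiv> 2 powr (- ((real (Suc m) + 1) / 2))"
  assumes C: "C \<in> inputs N (Suc m)" and m: "10 \<le> Suc m" and H: "H \<subseteq> set C"
    and top: "(\<forall>x\<in>H. x < 2 ^ m) \<or> (\<forall>x\<in>H. 2 ^ m \<le> x)"
  shows "q / 4 / real N * (\<Sum>(u, v)\<in>lt_pairs H. (real v - real u) * real (card {w \<in> H. v \<le> w}))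
    \<le> wkt (e_o (Suc m)) (Suc m) C"
proof -
  have C': "length C = N" "distinct C" "\<And>x. x \<in> set C \<Longrightarrow> x < 2 ^ Suc m" using C by (auto simp: inputs_def)
  have e: "\<And>j. 2 powr (- e_o (Suc m) j) = q" by (simp add: e_o_def q_def)
  have q: "4 * real (Suc m) * q \<le> 1" using e_o_flip_prob_small[OF m] by (simp add: q_def)
  have q0: "0 \<le> q" by (simp add: q_def)
  have "q / 4 / real N * (\<Sum>(u, v)\<in>lt_pairs H. (real v - real u) * real (card {w \<in> H. v \<le> w}))
    = (\<Sum>(u, v)\<in>lt_pairs H. (real v - real u) * (q / 4 * real (card {w \<in> H. v \<le> w}) / real (length C)))"
    unfolding C' by (simp add: sum_distrib_left case_prod_beta mult_ac)
  also have "\<dots> \<le> (\<Sum>(u, v)\<in>lt_pairs H. (real v - real u) *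
     measure_pmf.prob (quicksort (e_o (Suc m)) (Suc m) C) {out. occurs_before out v u})"
  proof (rule sum_mono, clarify)
    fix u v assume "(u, v) \<in> lt_pairs H"
    then have uv: "u \<in> H" "v \<in> H" "u < v" by (auto simp: lt_pairs_def)
    have "q / 4 * real (card {w \<in> H. v \<le> w}) / real (length C)
      \<le> measure_pmf.prob (quicksort (e_o (Suc m)) (Suc m) C) {out. occurs_before out v u}"
    proof (rule prob_inversion_ge)
      fix w assume w: "w \<in> {w \<in> H. v \<le> w}"
      then have w': "u < w" "w < 2 ^ Suc m" "2 ^ m \<le> u \<or> w < 2 ^ m" using uv H C' top by auto
      have "q / 2 * (1 / 2) \<le> measure_pmf.prob (cmp_less (e_o (Suc m)) (Suc m) u w) {c. \<not> c} *
         (if w = v then 1 else measure_pmf.prob (cmp_less (e_o (Suc m)) (Suc m) v w) {c. c})"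
        using prob_misplaced_same_top_ge[OF e q w'] prob_correct_ge[OF e q _ w'(2), of v] w q0
        by (intro mult_mono) auto
      then show "q / 4 \<le> measure_pmf.prob (cmp_less (e_o (Suc m)) (Suc m) u w) {c. \<not> c} *
         (if w = v then 1 else measure_pmf.prob (cmp_less (e_o (Suc m)) (Suc m) v w) {c. c})" by simp
    qed (use uv H C' in auto)
    then show "(real v - real u) * (q / 4 * real (card {w \<in> H. v \<le> w}) / real (length C))
      \<le> (real v - real u) * measure_pmf.prob (quicksort (e_o (Suc m)) (Suc m) C) {out. occurs_before out v u}"
      using uv by (intro mult_left_mono) auto
  qed
  also have "\<dots> \<le> wkt (e_o (Suc m)) (Suc m) C"
    unfolding wkt_eq_sum_lt_pairs[OF C'(2)] using lt_pairs_mono[OF H]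
    by (intro sum_mono2 finite_lt_pairs) (auto simp: lt_pairs_def)
  finally show ?thesis .
qed

text \<open>There are at least N^3/64 triples u < v \<le> w in \<open>H\<close>. The near pairs, at
  most N^2/128, account for at most N^3/128 of them, and every other triple has a gap of at least
  \<open>D\<close>.\<close>

lemma sum_gaps_ge:
  assumes "finite H" "2 \<le> card H" "N \<le> 2 * card H" "card H \<le> N"
    and "128 * card (lt_pairs H \<inter> near_pairs m D) \<le> N\<^sup>2"
  shows "real D * real N ^ 3 / 128
    \<le> (\<Sum>(u, v)\<in>lt_pairs H. (real v - real u) * real (card {w \<in> H. v \<le> w}))"
proof -
  define k where "k = card H"
  define T where "T = (\<Sum>(u, v)\<in>lt_pairs H. card {w \<in> H. v \<le> w})"
  have "6 * T + k = k ^ 3" using sum_card_above[OF assms(1)] by (simp add: T_def k_def)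
  \<comment> \<open>From k \<ge> 2: it turns 6T = k^3 - k into 6T \<ge> (3/4) k^3.\<close>
  moreover have "4 * k \<le> k ^ 3"
    using assms(2) mult_mono[of 2 k 2 k] by (simp add: k_def power3_eq_cube)
  ultimately have "k ^ 3 \<le> 8 * T" by linarith
  moreover have "N ^ 3 \<le> (2 * k) ^ 3" using assms(3) by (intro power_mono) (auto simp: k_def)
  ultimately have "N ^ 3 \<le> 64 * T" by (simp add: power_mult_distrib)
  then have "real (N ^ 3) \<le> real (64 * T)" by (rule of_nat_mono)
  then have T: "real N ^ 3 \<le> 64 * real T" by simp
  have B: "128 * real (card (lt_pairs H \<inter> near_pairs m D)) \<le> (real N)\<^sup>2"
    using of_nat_mono[OF assms(5), where 'a=real] by simp
  have "real D * real N ^ 3 / 128 = real D * (real N ^ 3 / 64 - (real N)\<^sup>2 / 128 * real N)"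
    by (simp add: power2_eq_square power3_eq_cube)
  also have "\<dots> \<le> real D * (real T - real (card (lt_pairs H \<inter> near_pairs m D)) * real N)"
    using T B by (intro mult_left_mono diff_mono mult_right_mono) auto
  \<comment> \<open>Each near pair is charged D * N, an upper bound for its own term, so its net
    contribution is at most 0.\<close>
  also have "\<dots> = (\<Sum>(u, v)\<in>lt_pairs H. real D * real (card {w \<in> H. v \<le> w}))
      - (\<Sum>z\<in>lt_pairs H. if z \<in> near_pairs m D then real D * real N else 0)"
    using assms(1) by (simp add: T_def sum.If_cases sum_distrib_left algebra_simps case_prod_beta)
  also have "\<dots> = (\<Sum>(u, v)\<in>lt_pairs H. real D * real (card {w \<in> H. v \<le> w})
       - (if (u, v) \<in> near_pairs m D then real D * real N else 0))"
    by (simp add: sum_subtractf case_prod_beta)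
  also have "\<dots> \<le> (\<Sum>(u, v)\<in>lt_pairs H. (real v - real u) * real (card {w \<in> H. v \<le> w}))"
  proof (rule sum_mono, clarify)
    fix u v assume "(u, v) \<in> lt_pairs H"
    then have uv: "u < v" by (auto simp: lt_pairs_def)
    have "card {w \<in> H. v \<le> w} \<le> N" using assms(1,4) card_mono[of H "{w \<in> H. v \<le> w}"] by fastforce
    then have 1: "real D * real (card {w \<in> H. v \<le> w}) \<le> real D * real N"
      by (intro mult_left_mono) auto
    have 0: "0 \<le> (real v - real u) * real (card {w \<in> H. v \<le> w})" using uv by simp
    have 2: "real D * real (card {w \<in> H. v \<le> w}) \<le> (real v - real u) * real (card {w \<in> H. v \<le> w})"
      if "(u, v) \<notin> near_pairs m D"
    proof (rule mult_right_mono)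
      have "u + D \<le> v" using that by (auto simp: near_pairs_def)
      then have "real (u + D) \<le> real v" unfolding of_nat_le_iff .
      then show "real D \<le> real v - real u" by simp
    qed simp
    show "real D * real (card {w \<in> H. v \<le> w}) - (if (u, v) \<in> near_pairs m D then real D * real N else 0)
        \<le> (real v - real u) * real (card {w \<in> H. v \<le> w})"
      using 0 1 2 by auto
  qed
  finally show ?thesis .
qed

subsection \<open>Good and bad inputs\<close>

text \<open>Bounding ln N below by 1/2 removes the logarithm at the price of a factor 2, which turns
  2^16 into 2^15.\<close>

lemma goodI:
  assumes "2 \<le> N" "0 < wkt e_a n C"
    and "2 powr (real n / 6) * wkt e_a n C \<le> 2 ^ 15 * real N * wkt (e_o n) n C"
  shows "good (1 / 2 ^ 16) N n C"
proof -
  have "1 / 2 \<le> ln (2::real)" using ln2_ge_two_thirds by simp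
  also have "\<dots> \<le> ln (real N)" using assms(1) by (subst ln_le_cancel_iff) auto
  finally have ln: "1 / 2 \<le> ln (real N)" .
  have "1 / 2 ^ 16 * 2 powr (real n / 6) / (real N * ln (real N))
     \<le> 1 / 2 ^ 16 * 2 powr (real n / 6) / (real N * (1 / 2))"
    using ln assms(1) by (intro divide_left_mono mult_left_mono mult_pos_pos) auto
  also have "\<dots> = 2 powr (real n / 6) / (2 ^ 15 * real N)" by simp
  also have "\<dots> \<le> wkt (e_o n) n C / wkt e_a n C"
    using assms by (simp add: field_simps)
  finally show ?thesis by (simp add: good_def)
qed

text \<open>Rounding 2n/3 down loses at most 2/3 in the exponent. The first bound makes the gaps
  large enough, the second makes the share D/2^n of near pairs small.\<close>

lemma pow_two_thirds_bounds:
  "2 powr (2 * real n / 3 - 2 / 3) \<le> real (2 ^ (2 * n div 3))"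
  "real (2 ^ (2 * n div 3)) * 2 powr (real n / 3) \<le> 2 ^ n"
proof -
  have D: "real (2 ^ (2 * n div 3)) = 2 powr real (2 * n div 3)" by (simp add: powr_realpow)
  have "3 * (2 * n div 3) \<le> 2 * n" "2 * n \<le> 3 * (2 * n div 3) + 2" by linarith+
  then have "real (3 * (2 * n div 3)) \<le> real (2 * n)" "real (2 * n) \<le> real (3 * (2 * n div 3) + 2)"
    unfolding of_nat_le_iff .
  then have b: "3 * real (2 * n div 3) \<le> 2 * real n" "2 * real n \<le> 3 * real (2 * n div 3) + 2"
    by (simp_all only: of_nat_mult of_nat_add of_nat_numeral)
  show "2 powr (2 * real n / 3 - 2 / 3) \<le> real (2 ^ (2 * n div 3))"
    unfolding D by (rule powr_mono) (use b in auto)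
  have "real (2 ^ (2 * n div 3)) * 2 powr (real n / 3) = 2 powr (real (2 * n div 3) + real n / 3)"
    unfolding D by (simp add: powr_add)
  also have "\<dots> \<le> 2 powr real n" by (rule powr_mono) (use b in auto)
  finally show "real (2 ^ (2 * n div 3)) * 2 powr (real n / 3) \<le> 2 ^ n" by (simp add: powr_realpow)
qed

lemma good_if_few_near_pairs:
  fixes m N :: nat
  defines "D \<equiv> 2 ^ (2 * Suc m div 3)"
  assumes C: "C \<in> inputs N (Suc m)" and m: "10 \<le> Suc m" and N: "2 \<le> N"
    and few: "128 * card (lt_pairs (set C) \<inter> near_pairs m D) \<le> N\<^sup>2"
  shows "good (1 / 2 ^ 16) N (Suc m) C"
proof -
  define n where "n = Suc m"
  define q where "q = 2 powr (- ((real n + 1) / 2))"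
  define X where "X = 2 powr (real n / 6)"
  have C': "length C = N" "distinct C" "\<And>x. x \<in> set C \<Longrightarrow> x < 2 ^ Suc m" using C by (auto simp: inputs_def)
  have cardC: "card (set C) = N" using C' by (simp add: distinct_card)
  have X0: "0 < X" by (simp add: X_def)
  have D0: "2 powr (2 * real n / 3 - 2 / 3) \<le> real D"
    using pow_two_thirds_bounds(1)[of n] by (simp add: D_def n_def)
  have "X \<le> 2 powr (2 * real n / 3 - 2 / 3)"
    unfolding X_def by (rule powr_mono) (use m in \<open>auto simp: n_def\<close>)
  then have XD: "X \<le> real D" using D0 by simp
  \<comment> \<open>The exponents of \<open>q\<close> and of the lower bound for \<open>D\<close>
    add up to n/6 - 7/6, which is at least n/6 - 2.\<close>
  have "X / 4 = 2 powr (real n / 6 - 2)" by (simp add: X_def powr_diff)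
  also have "\<dots> \<le> 2 powr (- ((real n + 1) / 2) + (2 * real n / 3 - 2 / 3))"
    by (rule powr_mono) (simp_all add: field_simps)
  also have "\<dots> = q * 2 powr (2 * real n / 3 - 2 / 3)" unfolding q_def by (rule powr_add)
  also have "\<dots> \<le> q * real D" using D0 by (intro mult_left_mono) (auto simp: q_def)
  finally have qD: "X / 4 \<le> q * real D" .
  have a_pos: "0 < wkt e_a n C" using wkt_e_a_pos[OF C N] by (simp add: n_def)
  have a_le: "wkt e_a n C \<le> 8 * real N ^ 3" using wkt_e_a_le[OF C] by (simp add: n_def)
  define L where "L = {x \<in> set C. x < 2 ^ m}"
  define U where "U = {x \<in> set C. 2 ^ m \<le> x}"
  have LU: "set C = L \<union> U" "L \<inter> U = {}" "finite L" "finite U" by (auto simp: L_def U_def)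
  have cardLU: "card L + card U = N" using cardC LU by (metis card_Un_disjoint)
  show ?thesis
  proof (cases "\<exists>H. (H = L \<or> H = U) \<and> 2 \<le> card H \<and> N \<le> 2 * card H")
    case True
    then obtain H where H: "H = L \<or> H = U" "2 \<le> card H" "N \<le> 2 * card H" by blast
    have Hsub: "H \<subseteq> set C" and top: "(\<forall>x\<in>H. x < 2 ^ m) \<or> (\<forall>x\<in>H. 2 ^ m \<le> x)"
      using H(1) by (auto simp: L_def U_def)
    have "lt_pairs H \<inter> near_pairs m D \<subseteq> lt_pairs (set C) \<inter> near_pairs m D"
      using lt_pairs_mono[OF Hsub] by auto
    then have "card (lt_pairs H \<inter> near_pairs m D) \<le> card (lt_pairs (set C) \<inter> near_pairs m D)"
      by (intro card_mono) auto
    then have fewH: "128 * card (lt_pairs H \<inter> near_pairs m D) \<le> N\<^sup>2" using few by linarith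
    have "card H \<le> N" using card_mono[OF _ Hsub] cardC by simp
    then have S: "real D * real N ^ 3 / 128
        \<le> (\<Sum>(u, v)\<in>lt_pairs H. (real v - real u) * real (card {w \<in> H. v \<le> w}))"
      using sum_gaps_ge[OF finite_subset[OF Hsub] H(2,3) _ fewH] by simp
    have "X * real N ^ 2 / 2048 = X / 4 * real N ^ 2 / 512" by simp
    also have "\<dots> \<le> q * real D * real N ^ 2 / 512" using qD by (intro divide_right_mono mult_right_mono) auto
    also have "\<dots> = q / 4 / real N * (real D * real N ^ 3 / 128)"
      using N by (simp add: power2_eq_square power3_eq_cube)
    also have "\<dots> \<le> q / 4 / real N *
        (\<Sum>(u, v)\<in>lt_pairs H. (real v - real u) * real (card {w \<in> H. v \<le> w}))"
      using S by (intro mult_left_mono) (auto simp: q_def)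
    also have "\<dots> \<le> wkt (e_o n) n C"
      using wkt_e_o_ge_half[OF C m Hsub top] by (simp add: q_def n_def)
    finally have o_ge: "X * real N ^ 2 / 2048 \<le> wkt (e_o n) n C" .
    have "X * wkt e_a n C \<le> X * (8 * real N ^ 3)" using a_le X0 by (intro mult_left_mono) auto
    also have "\<dots> \<le> 2 ^ 15 * real N * (X * real N ^ 2 / 2048)"
      using X0 by (simp add: power2_eq_square power3_eq_cube)
    also have "\<dots> \<le> 2 ^ 15 * real N * wkt (e_o n) n C" using o_ge by (intro mult_left_mono) auto
    finally show ?thesis using goodI[OF N a_pos] unfolding X_def n_def by blast
  next
    case False
    \<comment> \<open>The larger half always has at least N/2 entries. If it has fewer than two,
      then \<open>N = 2\<close> with one entry in each half.\<close>
    have "\<not> (2 \<le> card L \<and> N \<le> 2 * card L)" "\<not> (2 \<le> card U \<and> N \<le> 2 * card U)"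
      using False by auto
    then have N2: "N = 2" "card L = 1" "card U = 1" using cardLU N by linarith+
    then obtain u v where uv: "L = {u}" "U = {v}" by (metis card_1_singletonE)
    have C2: "set C = {u, v}" using LU uv by auto
    have "u \<in> L" "v \<in> U" using uv by auto
    then have bounds: "u < 2 ^ m" "2 ^ m \<le> v" "v < 2 ^ Suc m" using C'(3) by (auto simp: L_def U_def)
    then have less: "u < v" by simp
    have pairs: "lt_pairs (set C) = {(u, v)}" using less unfolding C2 by (auto simp: lt_pairs_def)
    \<comment> \<open>For two entries the assumption leaves no room for a single near pair.\<close>
    have "128 * card (lt_pairs (set C) \<inter> near_pairs m D) \<le> 4" using few unfolding N2 by simp
    then have "card (lt_pairs (set C) \<inter> near_pairs m D) = 0" by linarith
    then have "(u, v) \<notin> near_pairs m D" by (simp add: pairs)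
    then have far: "u + D \<le> v" "v < u + 2 ^ m \<or> u + 2 ^ m + D \<le> v"
      unfolding near_pairs_def by auto
    let ?P = "\<lambda>e. measure_pmf.prob (quicksort e n C) {out. occurs_before out v u}"
    have wkt: "wkt e n C = (real v - real u) * ?P e" for e
      unfolding wkt_eq_sum_lt_pairs[OF C'(2)] pairs by simp
    have e: "\<And>j. 2 powr (- e_o (Suc m) j) = q" by (simp add: e_o_def q_def n_def)
    have q: "4 * real (Suc m) * q \<le> 1" using e_o_flip_prob_small[OF m] by (simp add: q_def n_def)
    \<comment> \<open>The first pivot is \<open>v\<close> with probability 1/2, and then the
      comparison of \<open>u\<close> with \<open>v\<close> decides.\<close>
    have o_ge: "r / 2 \<le> ?P (e_o n)"
      if "r \<le> measure_pmf.prob (cmp_less (e_o n) n u v) {c. \<not> c}" for r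
    proof -
      have "r * real (card {v}) / real (length C) \<le> ?P (e_o n)"
        by (rule prob_inversion_ge) (use that C'(2) C2 less in auto)
      then show ?thesis using C'(1) N2 by simp
    qed
    from far(2) show ?thesis
    proof
      assume "v < u + 2 ^ m"
      then have P: "q / 2 / 2 \<le> ?P (e_o n)"
        using prob_misplaced_differing_top_ge[OF e q bounds] by (intro o_ge) (simp add: n_def)
      have "real (u + D) \<le> real v" using far(1) unfolding of_nat_le_iff .
      then have "real D * (q / 2 / 2) \<le> (real v - real u) * ?P (e_o n)"
        using P less by (intro mult_mono) (auto simp: q_def)
      then have "X / 16 \<le> wkt (e_o n) n C" using qD by (simp add: wkt mult_ac)
      moreover have "X * wkt e_a n C \<le> X * 64" using a_le X0 N2 by (intro mult_left_mono) auto
      moreover have "2 ^ 15 * real N * wkt (e_o n) n C = 65536 * wkt (e_o n) n C" using N2 by simp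
      ultimately have "X * wkt e_a n C \<le> 2 ^ 15 * real N * wkt (e_o n) n C" using X0 by linarith
      then show ?thesis using goodI[OF N a_pos] unfolding X_def n_def by blast
    next
      \<comment> \<open>Two flips are needed to exchange the entries if the low parts are read
        correctly. The gap exceeds 2^m, so \<open>e_o\<close> has weight at least 2^m * q^2/4 =
        1/16, whereas \<open>e_a\<close> has at most 34/D.\<close>
      assume far2: "u + 2 ^ m + D \<le> v"
      have P: "q\<^sup>2 / 2 / 2 \<le> ?P (e_o n)"
        using prob_misplaced_two_flips_ge[OF e q bounds] by (intro o_ge) (simp add: n_def)
      have qq: "q\<^sup>2 = 1 / (4 * 2 ^ m)" unfolding q_def e_o_flip_prob_square by (simp add: n_def)
      have far2': "real D \<le> real v - 2 ^ m - real u"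
      proof -
        have "real (u + 2 ^ m + D) \<le> real v" using far2 unfolding of_nat_le_iff .
        then show ?thesis by simp
      qed
      have "2 ^ m * (q\<^sup>2 / 2 / 2) \<le> (real v - real u) * ?P (e_o n)"
        using P far2' less by (intro mult_mono) auto
      then have o: "1 / 16 \<le> wkt (e_o n) n C" by (simp add: wkt qq)
      \<comment> \<open>17 = 16 + 1: the summand 1/2^n of the error bound is at most 1/D.\<close>
      define \<beta> where "\<beta> = 1 / 2 ^ n * (17 / real D)"
      have Dpos: "0 < real D" by (simp add: D_def)
      have "2 * Suc m div 3 \<le> n" unfolding n_def by presburger
      then have "real D \<le> 2 ^ n" unfolding D_def by (simp add: power_increasing)
      have "read_err e_a n v u \<le> 1 / 2 ^ n * (16 / (real v - 2 ^ m - real u) + 1 / 2 ^ n)"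
        using read_err_e_a_differing_top_le[OF bounds] far2 Dpos unfolding n_def by auto
      also have "\<dots> \<le> 1 / 2 ^ n * (16 / real D + 1 / real D)"
        using far2' Dpos \<open>real D \<le> 2 ^ n\<close>
        by (intro mult_left_mono add_mono divide_left_mono mult_pos_pos) auto
      finally have err: "read_err e_a n v u \<le> \<beta>" by (simp add: \<beta>_def add_divide_distrib)
      have "?P e_a \<le> real (length C) * \<beta>" unfolding quicksort_def
      proof (rule prob_inversion_le[OF C'(2) order_refl])
        show "u \<noteq> v" "0 \<le> \<beta>" using less by (auto simp: \<beta>_def)
        fix p assume "p \<in> set C"
        then show "(p \<noteq> v \<and> measure_pmf.prob (cmp_less e_a n v p) {c. c} \<le> \<beta>) \<or>
          (p \<noteq> u \<and> measure_pmf.prob (cmp_less e_a n u p) {c. \<not> c} \<le> \<beta>)"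
          using err less prob_cmp_less_False_eq[of e_a n u v] prob_cmp_less_True_le[of e_a n v u] C2
          by fastforce
      qed
      moreover have "real v < 2 ^ n" using of_nat_less_iff[of v "2 ^ n", where 'a=real] bounds(3) by (simp add: n_def)
      then have "real v - real u \<le> 2 ^ n" by linarith
      ultimately have "wkt e_a n C \<le> 2 ^ n * (2 * \<beta>)"
        unfolding wkt using C'(1) N2 by (intro mult_mono) auto
      then have "wkt e_a n C \<le> 34 / real D" by (simp add: \<beta>_def)
      then have "X * wkt e_a n C \<le> real D * (34 / real D)"
        using XD a_pos Dpos by (intro mult_mono) auto
      also have "\<dots> \<le> 2 ^ 15 * real N * wkt (e_o n) n C" using o N2 Dpos by simp
      finally show ?thesis using goodI[OF N a_pos] unfolding X_def n_def by blast
    qed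
  qed
qed

text \<open>Markov's inequality: a bad input contains at least N^2/128 near pairs, but by double
  counting near pairs are rare on average. The constant is 128 * 3 * 2, with 3 from the count of
  near pairs and 2 from V \<le> 2 (V - 1).\<close>

lemma card_bad_le:
  assumes n: "10 \<le> n" and N: "2 \<le> N"
  shows "real (card {C \<in> inputs N n. \<not> good (1 / 2 ^ 16) N n C}) * 2 powr (real n / 3)
    \<le> 768 * real (card (inputs N n))"
proof -
  obtain m where m: "n = Suc m" using n by (cases n) auto
  define D :: nat where "D = 2 ^ (2 * n div 3)"
  define I where "I = inputs N n"
  define Bad where "Bad = {C \<in> I. \<not> good (1 / 2 ^ 16) N n C}"
  define V :: nat where "V = 2 ^ n"
  define Q where "Q = lt_pairs {..<V} \<inter> near_pairs m D"
  define B where "B = (\<lambda>C. card (Q \<inter> lt_pairs (set C)))"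
  have finI: "finite I" by (simp add: I_def)
  have bad: "N\<^sup>2 \<le> 128 * B C" if "C \<in> Bad" for C
  proof (rule ccontr)
    assume neg: "\<not> N\<^sup>2 \<le> 128 * B C"
    have C: "C \<in> inputs N (Suc m)" using that by (simp add: Bad_def I_def m)
    then have "lt_pairs (set C) \<subseteq> lt_pairs {..<V}"
      by (intro lt_pairs_mono) (auto simp: inputs_def V_def m)
    then have "Q \<inter> lt_pairs (set C) = lt_pairs (set C) \<inter> near_pairs m D" by (auto simp: Q_def)
    then have "good (1 / 2 ^ 16) N (Suc m) C"
      using neg good_if_few_near_pairs[OF C _ N] n by (simp add: B_def D_def m)
    then show False using that by (simp add: Bad_def m)
  qed
  have "card Bad * N\<^sup>2 = (\<Sum>C\<in>Bad. N\<^sup>2)" by simp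
  also have "\<dots> \<le> (\<Sum>C\<in>Bad. 128 * B C)" by (rule sum_mono) (rule bad)
  also have "\<dots> \<le> (\<Sum>C\<in>I. 128 * B C)" using finI by (intro sum_mono2) (auto simp: Bad_def)
  finally have 1: "card Bad * N\<^sup>2 \<le> 128 * (\<Sum>C\<in>I. B C)" by (simp add: sum_distrib_left)
  have 2: "(\<Sum>C\<in>I. B C) * card (lt_pairs {..<V}) = card Q * (card I * card (lt_pairs {..<N}))"
    unfolding B_def I_def V_def by (rule sum_inputs_card_pairs) (simp add: Q_def V_def)
  have Q: "card Q \<le> V * (3 * D)" unfolding Q_def by (rule card_near_pairs_le)
  have pV: "2 * card (lt_pairs {..<V}) = V * (V - 1)"
    using card_lt_pairs[of "{..<V}"] by (simp add: power2_eq_square algebra_simps)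
  have pN: "2 * card (lt_pairs {..<N}) \<le> N\<^sup>2" using card_lt_pairs[of "{..<N}"] by simp
  have "card Bad * N\<^sup>2 * (V * (V - 1)) \<le> 128 * (\<Sum>C\<in>I. B C) * (2 * card (lt_pairs {..<V}))"
    unfolding pV[symmetric] using 1 by (intro mult_right_mono) auto
  also have "\<dots> = 128 * (card Q * (card I * (2 * card (lt_pairs {..<N}))))" using 2 by simp
  also have "\<dots> \<le> 128 * (V * (3 * D) * (card I * N\<^sup>2))"
    using Q pN by (intro mult_left_mono mult_mono) auto
  finally have "(N\<^sup>2 * V) * (card Bad * (V - 1)) \<le> (N\<^sup>2 * V) * (384 * D * card I)"
    by (simp add: mult_ac)
  moreover have "0 < N\<^sup>2 * V" using N by (simp add: V_def)
  ultimately have 3: "card Bad * (V - 1) \<le> 384 * D * card I" by (simp only: mult_le_cancel1)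
  have "V \<le> 2 * (V - 1)" using m by (simp add: V_def)
  then have "card Bad * V \<le> card Bad * (2 * (V - 1))" by simp
  also have "\<dots> \<le> 768 * D * card I" using 3 by simp
  finally have "real (card Bad * V) \<le> real (768 * D * card I)" by (rule of_nat_mono)
  then have 4: "real (card Bad) * 2 ^ n \<le> 768 * real D * real (card I)" by (simp add: V_def)
  have "real (card Bad) * 2 powr (real n / 3) * 2 ^ n \<le> 768 * real D * real (card I) * 2 powr (real n / 3)"
    using mult_right_mono[OF 4, of "2 powr (real n / 3)"] by (simp add: mult_ac)
  also have "\<dots> = 768 * real (card I) * (real D * 2 powr (real n / 3))" by simp
  also have "\<dots> \<le> 768 * real (card I) * 2 ^ n"
    using pow_two_thirds_bounds(2)[of n] by (intro mult_left_mono) (auto simp: D_def)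
  finally show ?thesis by (simp add: Bad_def I_def)
qed

text \<open>The ratio g/b is multiplied out, so b = 0 is covered. \<open>n0\<close> is uniform in
  \<open>N\<close>; for fixed \<open>N\<close> the factor in front of b tends to infinity with
  \<open>n\<close>.\<close>

theorem theorem7:
  shows "\<exists>c>0. \<exists>c'>0. \<exists>n0. \<forall>N\<ge>2. \<forall>n\<ge>n0.
     real (card {C \<in> inputs N n. good c N n C})
       \<ge> c' * (2 powr (real n / 3) / (real N)\<^sup>2) * real (card {C \<in> inputs N n. \<not> good c N n C})"
proof (intro exI conjI allI impI)
  \<comment> \<open>1536 = 2 * 768, and n \<ge> 33 gives 2^(n/3) \<ge> 2048 > 1536. So fewer than
    half of the inputs are bad, if there are any inputs, and their total number is at most twice
    that of the good ones.\<close>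
  show "(0::real) < 1 / 2 ^ 16" "(0::real) < 1 / 1536" by simp_all
  fix N n :: nat
  assume N: "2 \<le> N" and n: "33 \<le> n"
  define G where "G = {C \<in> inputs N n. good (1 / 2 ^ 16) N n C}"
  define B where "B = {C \<in> inputs N n. \<not> good (1 / 2 ^ 16) N n C}"
  define x where "x = 2 powr (real n / 3)"
  have "inputs N n = G \<union> B" "G \<inter> B = {}" by (auto simp: G_def B_def)
  moreover have "finite G" "finite B" by (auto simp: G_def B_def)
  ultimately have sum: "real (card (inputs N n)) = real (card G) + real (card B)"
    by (simp add: card_Un_disjoint)
  have B: "real (card B) * x \<le> 768 * real (card (inputs N n))"
    using card_bad_le[of n N] n N by (simp add: B_def x_def)
  have "(2::real) powr 11 \<le> x" unfolding x_def by (rule powr_mono) (use n in auto)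
  then have x: "2048 \<le> x" by simp
  have "real (card B) * 2048 \<le> real (card B) * x" using x by (intro mult_left_mono) auto
  then have half: "real (card (inputs N n)) \<le> 2 * real (card G)" using B sum by linarith
  \<comment> \<open>Division by N^2 \<ge> 1 only lowers the left-hand side.\<close>
  have "1 / 1536 * (x / (real N)\<^sup>2) * real (card B) \<le> 1 / 1536 * (x / 1) * real (card B)"
    using N x one_le_power[of "real N" 2]
    by (intro mult_right_mono mult_left_mono divide_left_mono) auto
  also have "\<dots> \<le> real (card G)" using B half by (simp add: mult.commute)
  finally show "1 / 1536 * (2 powr (real n / 3) / (real N)\<^sup>2) *
      real (card {C \<in> inputs N n. \<not> good (1 / 2 ^ 16) N n C})
      \<le> real (card {C \<in> inputs N n. good (1 / 2 ^ 16) N n C})"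
    unfolding x_def B_def G_def .
qed

end
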